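(* There is an absolute constant $c>0$ such that for every set $S$, every relation $f\subseteq\{0,1\}^n\times S$ and every partial Boolean function $g\subseteq\{0,1\}^m\times\{0,1\}$, \[\mathrm{R}_{1/3}(f\circ g^n)\ \ge\ c\cdot \mathrm{R}_{4/9}(f)\cdot\bar\chi(g),\] i.e. $\mathrm{R}_{1/3}(f\circ g^n)\in\Omega\left(\mathrm{R}_{4/9}(f)\cdot\bar\chi(g)\right)$.
   Context: Partial Boolean function: $g\subseteq\{0,1\}^m\times\{0,1\}$; $g^{-1}(b)$ is the set of $x$ with $(x,b)\in g$ and $(x,1-b)\notin g$; valid inputs are $g^{-1}(0)\cup g^{-1}(1)$; every non-valid input is related to both $0$ and $1$; for valid $x$, $g(x)$ is the unique $b$ with $(x,b)\in g$. Composition: $f\circ g^n\subseteq(\{0,1\}^m)^n\times S$, where $((x_1,\dots,x_n),s)\in f\circ g^n$ iff either some $x_i$ is not a valid input of $g$, or all $x_i$ are valid and $((g(x_1),\dots,g(x_n)),s)\in f$. For a relation $h\subseteq\{0,1\}^k\times S$ and $\epsilon\in[0,1/2)$, $\mathrm{R}_\epsilon(h)$ is the minimum, over randomized query algorithms $\mathcal A$ with $\Pr[(x,\mathcal A(x))\in h]\ge1-\epsilon$ for every $x$, of the worst-case number of queries. Decision trees: a deterministic decision tree $T$ on $\{0,1\}^m$ queries at each internal node $v$ an index $q(v)$ and moves to $v_0$ or $v_1$; leaves are labelled by bits; $T$ computes $g$ if it outputs $b$ on every $x\in g^{-1}(b)$. A node is identified with the subcube of inputs reaching it; $d_T(v)$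 is the number of vertices on the root-to-$v$ path (root has $d_T=1$); $\pi(v)$ is the parent. For distributions $\mu_0,\mu_1$ with $\mathrm{supp}(\mu_b)\subseteq g^{-1}(b)$: $p_b(v)=\Pr_{x\sim\mu_b}[x_{q(v)}=0\mid x\in v]$, $\Delta(v)=|p_0(v)-p_1(v)|$, $R(\text{root})=1$, $R(v)=R(\pi(v))\min_b\Pr_{x\sim\mu_b}[x\in v\mid x\in \pi(v)]$ (terms with $R(v)=0$ contribute $0$), and $\chi(T,(\mu_0,\mu_1))=\sum_{v}d_T(v)\Delta(v)R(v)$. For a distribution $\mathcal Q$ over such pairs, $\chi(T,\mathcal Q)=\mathbb E_{(\mu_0,\mu_1)\sim\mathcal Q}[\chi(T,(\mu_0,\mu_1))]$, and the max conflict complexity is $\bar\chi(g)=\max_{\mathcal Q}\min_T\chi(T,\mathcal Q)$, minimum over deterministic trees computing $g$. *)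

theory Defs
  imports "HOL-Probability.Probability"
begin

text \<open>
  Bits are booleans, with \<open>False\<close> for 0 and \<open>True\<close> for 1. The cube
  over an index set \<open>I\<close> consists of the extensional functions on \<open>I\<close>;
  \<open>{0,1}^k\<close> is the cube over \<open>{..<k}\<close>, and \<open>({0,1}^m)^n\<close> is identified
  with the cube over \<open>{..<n} \<times> {..<m}\<close>.
\<close>

definition cube :: "'i set \<Rightarrow> ('i \<Rightarrow> bool) set" where
  "cube I = I \<rightarrow>\<^sub>E UNIV"

definition block :: "nat \<Rightarrow> (nat \<times> nat \<Rightarrow> bool) \<Rightarrow> nat \<Rightarrow> (nat \<Rightarrow> bool)" where
  "block m x i = (\<lambda>j\<in>{..<m}. x (i, j))"


subsection \<open>Partial Boolean functions and composition\<close>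

definition preim :: "(('i \<Rightarrow> bool) \<times> bool) set \<Rightarrow> bool \<Rightarrow> ('i \<Rightarrow> bool) set" where
  "preim g b = {x. (x, b) \<in> g \<and> (x, \<not> b) \<notin> g}"

definition valid :: "(('i \<Rightarrow> bool) \<times> bool) set \<Rightarrow> ('i \<Rightarrow> bool) set" where
  "valid g = preim g False \<union> preim g True"

definition partial_boolean_function :: "'i set \<Rightarrow> (('i \<Rightarrow> bool) \<times> bool) set \<Rightarrow> bool" where
  "partial_boolean_function I g \<longleftrightarrow>
     g \<subseteq> cube I \<times> UNIV \<and> (\<forall>x\<in>cube I - valid g. \<forall>b. (x, b) \<in> g)"

definition pvalue :: "(('i \<Rightarrow> bool) \<times> bool) set \<Rightarrow> ('i \<Rightarrow> bool) \<Rightarrow> bool" where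
  "pvalue g x = (THE b. (x, b) \<in> g)"

definition compose ::
  "nat \<Rightarrow> nat \<Rightarrow> 's set \<Rightarrow> ((nat \<Rightarrow> bool) \<times> 's) set \<Rightarrow> ((nat \<Rightarrow> bool) \<times> bool) set
    \<Rightarrow> ((nat \<times> nat \<Rightarrow> bool) \<times> 's) set" where
  "compose n m S f g =
     {(x, s) \<in> cube ({..<n} \<times> {..<m}) \<times> S.
        (\<exists>i<n. block m x i \<notin> valid g) \<or>
        (\<forall>i<n. block m x i \<in> valid g) \<and> ((\<lambda>i\<in>{..<n}. pvalue g (block m x i)), s) \<in> f}"


subsection \<open>Decision trees and randomized query complexity\<close>

datatype (query_indices: 'i, outputs: 'a) dtree =
  Leaf 'a
| Query 'i "('i, 'a) dtree" "('i, 'a) dtree"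

definition dtrees :: "'i set \<Rightarrow> 'a set \<Rightarrow> ('i, 'a) dtree set" where
  "dtrees I S = {T. query_indices T \<subseteq> I \<and> outputs T \<subseteq> S}"

fun run :: "('i, 'a) dtree \<Rightarrow> ('i \<Rightarrow> bool) \<Rightarrow> 'a" where
  "run (Leaf a) x = a"
| "run (Query i T0 T1) x = run (if x i then T1 else T0) x"

fun num_queries :: "('i, 'a) dtree \<Rightarrow> ('i \<Rightarrow> bool) \<Rightarrow> nat" where
  "num_queries (Leaf a) x = 0"
| "num_queries (Query i T0 T1) x = Suc (num_queries (if x i then T1 else T0) x)"

text \<open>
  A randomized query algorithm is a probability distribution over deterministic trees.
  If some input is related to no output, no algorithm is admissible and the complexity
  is \<open>\<infinity>\<close> (the infimum of the empty set).
\<close>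

definition randomized_algorithms ::
  "'i set \<Rightarrow> 's set \<Rightarrow> real \<Rightarrow> (('i \<Rightarrow> bool) \<times> 's) set \<Rightarrow> ('i, 's) dtree pmf set" where
  "randomized_algorithms I S \<epsilon> h =
     {A. set_pmf A \<subseteq> dtrees I S \<and>
         (\<forall>x\<in>cube I. measure_pmf.prob A {T. (x, run T x) \<in> h} \<ge> 1 - \<epsilon>)}"

definition worst_case_queries :: "'i set \<Rightarrow> ('i, 's) dtree pmf \<Rightarrow> ennreal" where
  "worst_case_queries I A = (SUP T\<in>set_pmf A. SUP x\<in>cube I. of_nat (num_queries T x))"

definition R_complexity ::
  "'i set \<Rightarrow> 's set \<Rightarrow> real \<Rightarrow> (('i \<Rightarrow> bool) \<times> 's) set \<Rightarrow> ennreal" where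
  "R_complexity I S \<epsilon> h = (INF A\<in>randomized_algorithms I S \<epsilon> h. worst_case_queries I A)"


subsection \<open>Max conflict complexity\<close>

text \<open>
  A node of a tree is addressed by the list of answers on the path from the root, so the
  parent of \<open>v\<close> is \<open>butlast v\<close>.
\<close>

fun inner_nodes :: "('i, 'a) dtree \<Rightarrow> bool list set" where
  "inner_nodes (Leaf a) = {}"
| "inner_nodes (Query i T0 T1) =
     {[]} \<union> (#) False ` inner_nodes T0 \<union> (#) True ` inner_nodes T1"

fun node_query :: "('i, 'a) dtree \<Rightarrow> bool list \<Rightarrow> 'i" where
  "node_query (Leaf a) v = undefined"
| "node_query (Query i T0 T1) [] = i"
| "node_query (Query i T0 T1) (b # v) = node_query (if b then T1 else T0) v"

fun reaches :: "('i, 'a) dtree \<Rightarrow> ('i \<Rightarrow> bool) \<Rightarrow> bool list \<Rightarrow> bool" where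
  "reaches T x [] \<longleftrightarrow> True"
| "reaches (Leaf a) x (b # v) \<longleftrightarrow> False"
| "reaches (Query i T0 T1) x (b # v) \<longleftrightarrow> x i = b \<and> reaches (if b then T1 else T0) x v"

definition node_depth :: "bool list \<Rightarrow> nat" where
  "node_depth v = length v + 1"

definition prob_zero :: "('i, 'a) dtree \<Rightarrow> ('i \<Rightarrow> bool) pmf \<Rightarrow> bool list \<Rightarrow> real" where
  "prob_zero T \<mu> v = \<P>(x in measure_pmf \<mu>. x (node_query T v) = False \<bar> reaches T x v)"

definition node_gap ::
  "('i, 'a) dtree \<Rightarrow> ('i \<Rightarrow> bool) pmf \<Rightarrow> ('i \<Rightarrow> bool) pmf \<Rightarrow> bool list \<Rightarrow> real" where
  "node_gap T \<mu>0 \<mu>1 v = \<bar>prob_zero T \<mu>0 v - prob_zero T \<mu>1 v\<bar>"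

definition step_prob :: "('i, 'a) dtree \<Rightarrow> ('i \<Rightarrow> bool) pmf \<Rightarrow> bool list \<Rightarrow> real" where
  "step_prob T \<mu> v = \<P>(x in measure_pmf \<mu>. reaches T x v \<bar> reaches T x (butlast v))"

text \<open>
  Conditioning on a null event yields 0. If \<open>v\<close> has probability 0 under \<open>\<mu>0\<close> or \<open>\<mu>1\<close>,
  then \<open>node_weight\<close> vanishes at \<open>v\<close> and at all its descendants, so this value
  has no influence on \<open>conflict\<close>.
\<close>

fun node_weight ::
  "('i, 'a) dtree \<Rightarrow> ('i \<Rightarrow> bool) pmf \<Rightarrow> ('i \<Rightarrow> bool) pmf \<Rightarrow> bool list \<Rightarrow> real" where
  "node_weight T \<mu>0 \<mu>1 v =
     (if v = [] then 1
      else node_weight T \<mu>0 \<mu>1 (butlast v) * min (step_prob T \<mu>0 v) (step_prob T \<mu>1 v))"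

declare node_weight.simps [simp del]

definition conflict ::
  "('i, 'a) dtree \<Rightarrow> ('i \<Rightarrow> bool) pmf \<times> ('i \<Rightarrow> bool) pmf \<Rightarrow> real" where
  "conflict T = (\<lambda>(\<mu>0, \<mu>1).
     \<Sum>v\<in>inner_nodes T. real (node_depth v) * node_gap T \<mu>0 \<mu>1 v * node_weight T \<mu>0 \<mu>1 v)"

definition expected_conflict ::
  "('i, 'a) dtree \<Rightarrow> (('i \<Rightarrow> bool) pmf \<times> ('i \<Rightarrow> bool) pmf) pmf \<Rightarrow> real" where
  "expected_conflict T Q = measure_pmf.expectation Q (conflict T)"

definition computing_trees ::
  "'i set \<Rightarrow> (('i \<Rightarrow> bool) \<times> bool) set \<Rightarrow> ('i, bool) dtree set" where
  "computing_trees I g = {T \<in> dtrees I UNIV. \<forall>b. \<forall>x\<in>preim g b. run T x = b}"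

definition input_pairs ::
  "(('i \<Rightarrow> bool) \<times> bool) set \<Rightarrow> (('i \<Rightarrow> bool) pmf \<times> ('i \<Rightarrow> bool) pmf) set" where
  "input_pairs g = {(\<mu>0, \<mu>1). set_pmf \<mu>0 \<subseteq> preim g False \<and> set_pmf \<mu>1 \<subseteq> preim g True}"

text \<open>
  If \<open>g\<close> takes only one value on its valid inputs (or has none), there is no pair of
  distributions, and the value is 0 (the supremum of the empty set).
\<close>

definition max_conflict_complexity ::
  "'i set \<Rightarrow> (('i \<Rightarrow> bool) \<times> bool) set \<Rightarrow> ennreal" where
  "max_conflict_complexity I g =
     (SUP Q\<in>{Q. set_pmf Q \<subseteq> input_pairs g}.
        INF T\<in>computing_trees I g. ennreal (expected_conflict T Q))"


subsection \<open>The composition bound\<close>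

text \<open>
  \<open>composition_bound TYPE('s) c\<close>: the constant \<open>c\<close> works for all output sets
  \<open>S\<close> whose elements have type \<open>'s\<close>. The type argument is needed because a
  quantifier over types is not available under the quantifier over \<open>c\<close>: that some
  \<open>c\<close> works for all sets \<open>S\<close> whatsoever is expressed by saying that some \<open>c\<close> works
  for outputs in \<open>nat\<close>, and that each such \<open>c\<close> also works for outputs in an
  arbitrary type.
\<close>

definition composition_bound :: "'s itself \<Rightarrow> real \<Rightarrow> bool" where
  "composition_bound (_ :: 's itself) c \<longleftrightarrow>
     (\<forall>n m (S :: 's set) f g.
        f \<subseteq> cube {..<n} \<times> S \<longrightarrow> partial_boolean_function {..<m} g \<longrightarrow>
        R_complexity ({..<n} \<times> {..<m}) S (1/3) (compose n m S f g)
          \<ge> ennreal c * R_complexity {..<n} S (4/9) f * max_conflict_complexity {..<m} g)"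

end

theory Submission
  imports Defs
begin

text \<open>
  Let \<open>Q\<close> be a nearly optimal distribution for the max conflict complexity \<open>X\<close> of \<open>g\<close>. An algorithm
  for \<open>f\<close> on input \<open>z\<close> runs a given algorithm for the composed relation, sampling the \<open>i\<close>-th block from
  the \<open>z i\<close>-th component of a pair drawn from \<open>Q\<close>. The answers under the two components are
  maximally coupled, and \<open>z i\<close> is queried only when they differ for the first time.
  The number of block queries spent per query to \<open>z\<close> is at least \<open>X\<close> on average: otherwise, cutting
  the tree of one block at some point and continuing optimally for the conditional distribution of
  the surviving pairs would beat the value of \<open>Q\<close>. Hence the expected number of queries to \<open>z\<close> is
  at most the query complexity of the composed relation divided by \<open>X\<close>. Stopping after \<open>9\<close> times this
  number costs an additional error of \<open>1/9 = 4/9 - 1/3\<close>, by Markov's inequality. The blocks are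
  replaced one at a time, with the other variables held fixed.
\<close>

section \<open>Answers to a query, conditioning on them, and the maximal coupling\<close>

lemma nn_integral_bool_pair:
  fixes M :: "(bool \<times> bool) pmf"
  shows "(\<integral>\<^sup>+ c. f c \<partial>measure_pmf M) =
    ennreal (pmf M (False, False)) * f (False, False) + ennreal (pmf M (False, True)) * f (False, True) +
    ennreal (pmf M (True, False)) * f (True, False) + ennreal (pmf M (True, True)) * f (True, True)"
proof -
  have U: "(UNIV :: (bool \<times> bool) set) =
      {(False, False), (False, True), (True, False), (True, True)}"
    by auto
  show ?thesis
    by (simp add: nn_integral_measure_pmf nn_integral_count_space_finite U add.assoc)
qed

definition answer :: "('i \<Rightarrow> bool) pmf \<Rightarrow> 'i \<Rightarrow> bool pmf" where
  "answer \<mu> i = map_pmf (\<lambda>x. x i) \<mu>"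

lemma pmf_answer: "pmf (answer \<mu> i) b = measure_pmf.prob \<mu> {x. x i = b}"
  by (simp add: answer_def pmf_map vimage_def)

lemma pmf_bool_sum: "pmf M False + pmf M True = 1"
  using sum_pmf_eq_1[of "UNIV :: bool set" M] unfolding UNIV_bool[symmetric] by (simp only: finite subset_UNIV simp_thms) (simp add: UNIV_bool)

text \<open>Off the support the conditional distribution is a junk value, which only ever
  occurs with weight 0.\<close>

definition pcond :: "('i \<Rightarrow> bool) pmf \<Rightarrow> 'i \<Rightarrow> bool \<Rightarrow> ('i \<Rightarrow> bool) pmf" where
  "pcond \<mu> i b = (if b \<in> set_pmf (answer \<mu> i) then cond_pmf \<mu> {x. x i = b} else \<mu>)"

lemma set_answer_iff: "b \<in> set_pmf (answer \<mu> i) \<longleftrightarrow> set_pmf \<mu> \<inter> {x. x i = b} \<noteq> {}"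
  unfolding answer_def set_map_pmf by blast

lemma set_pcond_subset: "set_pmf (pcond \<mu> i b) \<subseteq> set_pmf \<mu>"
  by (auto simp: pcond_def set_answer_iff)

lemma set_pcond_answer:
  assumes "b \<in> set_pmf (answer \<mu> i)" "x \<in> set_pmf (pcond \<mu> i b)"
  shows "x i = b"
  using assms by (auto simp: pcond_def set_answer_iff)

text \<open>The law of total probability; it allows an input to be sampled lazily, one answer at a
  time.\<close>

lemma bind_answer_pcond: "bind_pmf (answer \<mu> i) (pcond \<mu> i) = \<mu>"
proof -
  have "bind_pmf (answer \<mu> i) (pcond \<mu> i) =
      bind_pmf (answer \<mu> i) (\<lambda>b. cond_pmf \<mu> {x. x i = b})"
    by (intro bind_pmf_cong) (auto simp: pcond_def)
  also have "\<dots> = \<mu>"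
  proof (rule bind_cond_pmf_cancel)
    fix b :: bool and y :: "'a \<Rightarrow> bool" assume "y i = b"
    then have "{x. y i = x} = {b}" by auto
    then show "measure_pmf.prob \<mu> {y. y i = b} = measure_pmf.prob (answer \<mu> i) {x. y i = x}"
      by (simp add: pmf_answer[symmetric] measure_pmf_single)
  next
    fix b assume "b \<in> set_pmf (answer \<mu> i)"
    then show "set_pmf \<mu> \<inter> {x. x i = b} \<noteq> {}" by (simp add: set_answer_iff)
  next
    fix y assume "y \<in> set_pmf \<mu>"
    then show "set_pmf (answer \<mu> i) \<inter> {b. y i = b} \<noteq> {}"
      unfolding answer_def set_map_pmf by blast
  qed
  finally show ?thesis .
qed

lemma prob_pcond:
  assumes "b \<in> set_pmf (answer \<mu> i)"
  shows "measure_pmf.prob (pcond \<mu> i b) S =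
    measure_pmf.prob \<mu> (S \<inter> {x. x i = b}) / pmf (answer \<mu> i) b"
proof -
  have ne: "set_pmf \<mu> \<inter> {x. x i = b} \<noteq> {}" using assms by (simp add: set_answer_iff)
  then have "measure_pmf.prob (cond_pmf \<mu> {x. x i = b}) S =
      measure_pmf.prob \<mu> ({x. x i = b} \<inter> S) / measure_pmf.prob \<mu> {x. x i = b}"
    by (simp add: cond_pmf.rep_eq measure_uniform_measure emeasure_measure_pmf_not_zero)
  then show ?thesis using assms by (simp add: pcond_def pmf_answer Int_commute)
qed

text \<open>The maximal coupling of two bits. Off the diagonal the positive part of one difference
  suffices, since \<open>pmf p a - pmf q a\<close> changes sign when \<open>a\<close> is
  negated.\<close>

definition coupling :: "bool pmf \<Rightarrow> bool pmf \<Rightarrow> (bool \<times> bool) pmf" where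
  "coupling p q = embed_pmf (\<lambda>(a, b).
     if a = b then min (pmf p a) (pmf q a) else max 0 (pmf p a - pmf q a))"

lemma pmf_coupling:
  "pmf (coupling p q) (a, b) =
     (if a = b then min (pmf p a) (pmf q a) else max 0 (pmf p a - pmf q a))"
proof -
  have U: "(UNIV :: (bool \<times> bool) set) =
      {(False, False), (False, True), (True, False), (True, True)}"
    by auto
  define F where "F = (\<lambda>(a, b). if a = b then min (pmf p a) (pmf q a)
    else max 0 (pmf p a - pmf q a))"
  have nonneg: "0 \<le> F c" for c by (cases c) (auto simp: F_def)
  have "(\<integral>\<^sup>+ c. ennreal (F c) \<partial>count_space UNIV) = ennreal (\<Sum>c\<in>UNIV. F c)"
    by (simp add: nn_integral_count_space_finite U nonneg del: sum.insert)
  also have "(\<Sum>c\<in>UNIV. F c) = 1"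
    using pmf_bool_sum[of p] pmf_bool_sum[of q] by (simp add: U F_def)
  finally have "pmf (embed_pmf F) (a, b) = F (a, b)"
    by (intro pmf_embed_pmf nonneg) simp_all
  then show ?thesis by (simp add: F_def coupling_def)
qed

lemma map_coupling:
  "map_pmf fst (coupling p q) = p" "map_pmf snd (coupling p q) = q"
proof -
  have "pmf (map_pmf fst (coupling p q)) a = pmf p a"
    and "pmf (map_pmf snd (coupling p q)) a = pmf q a" for a
  proof -
    have f: "fst -` {a} = {(a, a), (a, \<not> a)}" and s: "snd -` {a} = {(a, a), (\<not> a, a)}" 
      by (auto simp: vimage_def prod_eq_iff intro!: set_eqI)
    have "pmf (map_pmf fst (coupling p q)) a = pmf (coupling p q) (a, a) + pmf (coupling p q) (a, \<not> a)"
      by (simp add: pmf_map f measure_measure_pmf_finite)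
    then show "pmf (map_pmf fst (coupling p q)) a = pmf p a" by (simp add: pmf_coupling)
    have "pmf (map_pmf snd (coupling p q)) a = pmf (coupling p q) (a, a) + pmf (coupling p q) (\<not> a, a)"
      by (simp add: pmf_map s measure_measure_pmf_finite)
    then show "pmf (map_pmf snd (coupling p q)) a = pmf q a"
      using pmf_bool_sum[of p] pmf_bool_sum[of q] by (cases a) (auto simp: pmf_coupling)
  qed
  then show "map_pmf fst (coupling p q) = p" "map_pmf snd (coupling p q) = q"
    by (auto intro: pmf_eqI)
qed

lemma set_coupling:
  assumes "c \<in> set_pmf (coupling p q)"
  shows "fst c \<in> set_pmf p" "snd c \<in> set_pmf q"
  using imageI[OF assms, of fst] imageI[OF assms, of snd]
  by (simp_all add: map_coupling flip: set_map_pmf)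

section \<open>The coupled process on a pair of distributions\<close>

type_synonym 'i pmf_pair = "('i \<Rightarrow> bool) pmf \<times> ('i \<Rightarrow> bool) pmf"

definition pair_answer :: "'i pmf_pair \<Rightarrow> 'i \<Rightarrow> (bool \<times> bool) pmf" where
  "pair_answer p i = coupling (answer (fst p) i) (answer (snd p) i)"

definition pair_cond :: "'i pmf_pair \<Rightarrow> 'i \<Rightarrow> bool \<Rightarrow> 'i pmf_pair" where
  "pair_cond p i b = (pcond (fst p) i b, pcond (snd p) i b)"

text \<open>\<open>None\<close> records that the coupled answers to some query differed.\<close>

fun coupled_run :: "('i, 'a) dtree \<Rightarrow> 'i pmf_pair \<Rightarrow> 'i pmf_pair option pmf" where
  "coupled_run (Leaf a) p = return_pmf (Some p)"
| "coupled_run (Query i T0 T1) p = bind_pmf (pair_answer p i) (\<lambda>c.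
     if fst c = snd c then coupled_run (if fst c then T1 else T0) (pair_cond p i (fst c))
     else return_pmf None)"

text \<open>The expected number of queries up to and including the first one with differing answers,
  or up to a leaf.\<close>

fun conflict_time :: "('i, 'a) dtree \<Rightarrow> 'i pmf_pair \<Rightarrow> ennreal" where
  "conflict_time (Leaf a) p = 0"
| "conflict_time (Query i T0 T1) p = 1 + (\<integral>\<^sup>+ c.
     (if fst c = snd c then conflict_time (if fst c then T1 else T0) (pair_cond p i (fst c))
     else 0) \<partial>measure_pmf (pair_answer p i))"

fun graft :: "('i, 'a) dtree \<Rightarrow> ('i, 'b) dtree \<Rightarrow> ('i, 'b) dtree" where
  "graft (Leaf a) T = T"
| "graft (Query i T0 T1) T = Query i (graft T0 T) (graft T1 T)"

lemma run_graft [simp]: "run (graft U T) x = run T x"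
  by (induction U) auto

lemma graft_in_dtrees: "query_indices U \<subseteq> I \<Longrightarrow> T \<in> dtrees I S \<Longrightarrow> graft U T \<in> dtrees I S"
  by (induction U) (auto simp: dtrees_def)

text \<open>A Markov property: the process on \<open>T\<close> starts from the conditional pair with
  which \<open>U\<close> ended, and after a conflict nothing more is counted.\<close>

lemma conflict_time_graft:
  "conflict_time (graft U T) p = conflict_time U p +
     (\<integral>\<^sup>+ r. (case r of None \<Rightarrow> 0 | Some p' \<Rightarrow> conflict_time T p') \<partial>measure_pmf (coupled_run U p))"
proof (induction U arbitrary: p)
  case (Query i T0 T1)
  have "conflict_time (graft (Query i T0 T1) T) p = 1 + (\<integral>\<^sup>+ c.
      (if fst c = snd c then conflict_time (if fst c then T1 else T0) (pair_cond p i (fst c)) else 0) +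
      (\<integral>\<^sup>+ r. (case r of None \<Rightarrow> 0 | Some p' \<Rightarrow> conflict_time T p') \<partial>measure_pmf
        (if fst c = snd c then coupled_run (if fst c then T1 else T0) (pair_cond p i (fst c))
         else return_pmf None)) \<partial>measure_pmf (pair_answer p i))"
    by (auto simp: Query.IH intro!: nn_integral_cong)
  also have "\<dots> = conflict_time (Query i T0 T1) p +
      (\<integral>\<^sup>+ r. (case r of None \<Rightarrow> 0 | Some p' \<Rightarrow> conflict_time T p')
        \<partial>measure_pmf (coupled_run (Query i T0 T1) p))"
    by (simp add: nn_integral_add add.assoc)
  finally show ?case .
qed auto

text \<open>A crude bound of which only the finiteness matters, for integrability and for
  cancellation in \<open>ennreal\<close>.\<close>

lemma conflict_time_le_size: "conflict_time T p \<le> of_nat (size T)"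
proof (induction T arbitrary: p)
  case (Query i T0 T1)
  have "(if fst c = snd c then conflict_time (if fst c then T1 else T0) (pair_cond p i (fst c)) else 0)
      \<le> of_nat (size T0) + of_nat (size T1)" for c
    using Query.IH(1)[of "pair_cond p i (fst c)"] Query.IH(2)[of "pair_cond p i (fst c)"]
    by (auto intro: order_trans add_increasing add_increasing2)
  then have "(\<integral>\<^sup>+ c. (if fst c = snd c then conflict_time (if fst c then T1 else T0)
      (pair_cond p i (fst c)) else 0) \<partial>measure_pmf (pair_answer p i))
      \<le> (\<integral>\<^sup>+ c. of_nat (size T0) + of_nat (size T1) \<partial>measure_pmf (pair_answer p i))"
    by (intro nn_integral_mono) 
  then show ?case by (simp add: add.commute add_left_mono)
qed auto

text \<open>Conditioning only shrinks supports. Hence the conditional distribution of the surviving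
  pairs competes in the supremum that defines the max conflict complexity.\<close>

lemma coupled_run_input_pairs:
  assumes "p \<in> input_pairs g" "Some p' \<in> set_pmf (coupled_run U p)"
  shows "p' \<in> input_pairs g"
  using assms
proof (induction U arbitrary: p)
  case (Query i T0 T1)
  have pc: "pair_cond p i b \<in> input_pairs g" for b
    using Query.prems(1) set_pcond_subset[of "fst p" i b] set_pcond_subset[of "snd p" i b]
    by (fastforce simp: input_pairs_def pair_cond_def)
  show ?case using Query.prems(2) Query.IH(1)[OF pc] Query.IH(2)[OF pc] by (auto split: if_splits)
qed auto

section \<open>Conflict as the expected time of the first differing answers\<close>

text \<open>The diagonal mass of the maximal coupling.\<close>

definition agree_prob :: "'i pmf_pair \<Rightarrow> 'i \<Rightarrow> bool \<Rightarrow> real" where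
  "agree_prob p i b = min (pmf (answer (fst p) i) b) (pmf (answer (snd p) i) b)"

lemma agree_prob_nonneg [simp]: "0 \<le> agree_prob p i b"
  by (simp add: agree_prob_def)

lemma agree_prob_pos_iff:
  "agree_prob p i b \<noteq> 0 \<longleftrightarrow> b \<in> set_pmf (answer (fst p) i) \<and> b \<in> set_pmf (answer (snd p) i)"
  by (auto simp: agree_prob_def set_pmf_iff min_def)

lemma pair_answer_integral:
  "(\<integral>\<^sup>+ c. (if fst c = snd c then F (fst c) else 0) \<partial>measure_pmf (pair_answer p i)) =
     ennreal (agree_prob p i False) * F False + ennreal (agree_prob p i True) * F True"
  by (simp add: nn_integral_bool_pair pair_answer_def pmf_coupling agree_prob_def)

text \<open>Reaching \<open>b # v\<close> means answering \<open>b\<close> at the root and then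
  reaching \<open>v\<close>; the normalization by the probability of \<open>b\<close> cancels in the
  conditional probability.\<close>

lemma prob_zero_Cons:
  assumes "b \<in> set_pmf (answer \<mu> i)"
  shows "prob_zero (Query i T0 T1) \<mu> (b # v) = prob_zero (if b then T1 else T0) (pcond \<mu> i b) v"
proof -
  have "pmf (answer \<mu> i) b \<noteq> 0" using assms by (simp add: set_pmf_iff)
  then show ?thesis using assms
    by (simp add: prob_zero_def cond_prob_def prob_pcond Int_def conj_ac)
qed

lemma step_prob_single: "step_prob (Query i T0 T1) \<mu> [b] = pmf (answer \<mu> i) b"
  by (simp add: step_prob_def cond_prob_def pmf_answer)

lemma step_prob_Cons:
  assumes "b \<in> set_pmf (answer \<mu> i)" "v \<noteq> []"
  shows "step_prob (Query i T0 T1) \<mu> (b # v) = step_prob (if b then T1 else T0) (pcond \<mu> i b) v"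
proof -
  have "pmf (answer \<mu> i) b \<noteq> 0" using assms by (simp add: set_pmf_iff)
  then show ?thesis using assms
    by (simp add: step_prob_def cond_prob_def prob_pcond Int_def conj_ac)
qed

lemma node_weight_Nil: "node_weight T \<mu>0 \<mu>1 [] = 1"
  by (subst node_weight.simps) simp

lemma node_weight_snoc:
  "node_weight T \<mu>0 \<mu>1 (v @ [b]) = node_weight T \<mu>0 \<mu>1 v *
     min (step_prob T \<mu>0 (v @ [b])) (step_prob T \<mu>1 (v @ [b]))"
  by (subst node_weight.simps) simp

text \<open>The definition recurses at the end of the address, trees recurse at the root, so the
  first step is split off by induction from the end. If that step has weight 0, both sides vanish
  and junk conditional distributions do no harm.\<close>

lemma node_weight_Cons:
  "node_weight (Query i T0 T1) \<mu>0 \<mu>1 (b # v) = agree_prob (\<mu>0, \<mu>1) i b *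
     node_weight (if b then T1 else T0) (pcond \<mu>0 i b) (pcond \<mu>1 i b) v"
proof (induction v rule: rev_induct)
  case Nil
  show ?case
    using node_weight_snoc[of "Query i T0 T1" \<mu>0 \<mu>1 "[]" b]
    by (simp add: node_weight_Nil step_prob_single agree_prob_def)
next
  case (snoc a v)
  have "node_weight (Query i T0 T1) \<mu>0 \<mu>1 (b # v @ [a]) = node_weight (Query i T0 T1) \<mu>0 \<mu>1 (b # v) *
      min (step_prob (Query i T0 T1) \<mu>0 (b # v @ [a])) (step_prob (Query i T0 T1) \<mu>1 (b # v @ [a]))"
    using node_weight_snoc[of "Query i T0 T1" \<mu>0 \<mu>1 "b # v" a] by simp
  also have "\<dots> = agree_prob (\<mu>0, \<mu>1) i b *
     node_weight (if b then T1 else T0) (pcond \<mu>0 i b) (pcond \<mu>1 i b) (v @ [a])"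
  proof (cases "agree_prob (\<mu>0, \<mu>1) i b = 0")
    case True
    then show ?thesis by (simp only: snoc.IH)
  next
    case False
    then have "b \<in> set_pmf (answer \<mu>0 i)" "b \<in> set_pmf (answer \<mu>1 i)"
      by (simp_all add: agree_prob_pos_iff)
    then show ?thesis
      by (simp add: node_weight_snoc snoc.IH step_prob_Cons)
  qed
  finally show ?case by simp
qed

text \<open>Passing to a child shifts all depths by one, so the factor for the depth is kept
  general. The constant factor 1 gives the probability of a conflict.\<close>

definition weighted_gap :: "(nat \<Rightarrow> real) \<Rightarrow> ('i, 'a) dtree \<Rightarrow> 'i pmf_pair \<Rightarrow> real" where
  "weighted_gap w T p = (\<Sum>v\<in>inner_nodes T.
     w (length v) * node_gap T (fst p) (snd p) v * node_weight T (fst p) (snd p) v)"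

lemma finite_inner_nodes [simp]: "finite (inner_nodes T)"
  by (induction T) auto

lemma weighted_gap_Query:
  "weighted_gap w (Query i T0 T1) p = w 0 * (1 - agree_prob p i False - agree_prob p i True) +
     agree_prob p i False * weighted_gap (\<lambda>k. w (Suc k)) T0 (pair_cond p i False) +
     agree_prob p i True * weighted_gap (\<lambda>k. w (Suc k)) T1 (pair_cond p i True)"
proof -
  define h where "h T p v = node_gap T (fst p) (snd p) v * node_weight T (fst p) (snd p) v"
    for T :: "('a, 'b) dtree" and p v
  let ?T = "Query i T0 T1"
  have G: "weighted_gap w T p = (\<Sum>v\<in>inner_nodes T. w (length v) * h T p v)" for w T p
    by (simp add: weighted_gap_def h_def mult.assoc)
  have "prob_zero ?T \<mu> [] = pmf (answer \<mu> i) False" for \<mu>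
    by (simp add: prob_zero_def cond_prob_def pmf_answer)
  \<comment> \<open>For two bits, the gap of the probabilities of 0 is the mass off the diagonal of
    the maximal coupling.\<close>
  then have root: "h ?T p [] = 1 - agree_prob p i False - agree_prob p i True"
    using pmf_bool_sum[of "answer (fst p) i"] pmf_bool_sum[of "answer (snd p) i"]
    by (simp add: h_def node_gap_def node_weight.simps agree_prob_def min_def)
  have h_Cons: "h ?T p (b # v) = agree_prob p i b * h (if b then T1 else T0) (pair_cond p i b) v" for b v
  proof (cases "agree_prob p i b = 0")
    case False
    then show ?thesis
      by (simp add: h_def node_weight_Cons node_gap_def prob_zero_Cons agree_prob_pos_iff pair_cond_def)
  qed (simp add: h_def node_weight_Cons)
  have "weighted_gap w ?T p = w 0 * h ?T p [] + (\<Sum>v\<in>inner_nodes T0. w (Suc (length v)) * h ?T p (False # v)) +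
      (\<Sum>v\<in>inner_nodes T1. w (Suc (length v)) * h ?T p (True # v))"
  proof -
    have "inner_nodes ?T = insert [] ((#) False ` inner_nodes T0 \<union> (#) True ` inner_nodes T1)" by simp
    then show ?thesis
      unfolding G
      by (subst \<open>inner_nodes ?T = _\<close>, subst sum.insert, simp, force)
        (subst sum.union_disjoint; auto simp: sum.reindex)
  qed
  then show ?thesis
    by (simp add: root h_Cons G sum_distrib_left mult_ac)
qed

lemma conflict_eq_weighted_gap: "conflict T p = weighted_gap (\<lambda>k. real k + 1) T p"
  by (simp add: conflict_def weighted_gap_def node_depth_def case_prod_unfold add.commute)

text \<open>A pair that reached a leaf would have the same output under both distributions, so
  the process ends with a conflict almost surely, and \<open>conflict\<close> is the expected time of it.\<close>

lemma conflict_eq_conflict_time: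
  assumes "\<And>x. x \<in> set_pmf (fst p) \<Longrightarrow> \<not> run T x" "\<And>x. x \<in> set_pmf (snd p) \<Longrightarrow> run T x"
  shows "weighted_gap (\<lambda>_. 1) T p = 1 \<and> 0 \<le> conflict T p \<and> ennreal (conflict T p) = conflict_time T p"
  using assms
proof (induction T arbitrary: p)
  case (Leaf a)
  obtain x y where "x \<in> set_pmf (fst p)" "y \<in> set_pmf (snd p)"
    using set_pmf_not_empty by (metis all_not_in_conv)
  then have False using Leaf by auto
  then show ?case ..
next
  case (Query i T0 T1)
  let ?T = "\<lambda>b. if b then T1 else T0"
  \<comment> \<open>If \<open>b\<close> has agreement probability 0, the conditional pair may be
    junk and violate the assumptions on the outputs.\<close>
  have IH: "weighted_gap (\<lambda>_. 1) (?T b) (pair_cond p i b) = 1 \<and> 0 \<le> conflict (?T b) (pair_cond p i b)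
      \<and> ennreal (conflict (?T b) (pair_cond p i b)) = conflict_time (?T b) (pair_cond p i b)"
    if "agree_prob p i b \<noteq> 0" for b
  proof -
    have b: "b \<in> set_pmf (answer (fst p) i)" "b \<in> set_pmf (answer (snd p) i)"
      using that by (auto simp: agree_prob_pos_iff)
    have "\<not> run (?T b) x" if "x \<in> set_pmf (fst (pair_cond p i b))" for x
      using that Query.prems(1)[of x] set_pcond_answer[OF b(1), of x] set_pcond_subset[of "fst p" i b]
      by (auto simp: pair_cond_def)
    moreover have "run (?T b) x" if "x \<in> set_pmf (snd (pair_cond p i b))" for x
      using that Query.prems(2)[of x] set_pcond_answer[OF b(2), of x] set_pcond_subset[of "snd p" i b]
      by (auto simp: pair_cond_def)
    ultimately show ?thesis
      using Query.IH[of "pair_cond p i b"] by (cases b) auto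
  qed
  have gap1: "weighted_gap (\<lambda>_. 1) (Query i T0 T1) p = 1"
    using IH[of False] IH[of True] by (simp add: weighted_gap_Query) fastforce
  \<comment> \<open>Raising every depth by one adds the total conflict probability of the subtree,
    which is 1 by induction.\<close>
  have *: "agree_prob p i b * weighted_gap (\<lambda>k. real (Suc k) + 1) (?T b) (pair_cond p i b) =
      agree_prob p i b * conflict (?T b) (pair_cond p i b) + agree_prob p i b" for b
  proof -
    have "weighted_gap (\<lambda>k. real (Suc k) + 1) (?T b) (pair_cond p i b) =
      conflict (?T b) (pair_cond p i b) + weighted_gap (\<lambda>_. 1) (?T b) (pair_cond p i b)"
      by (simp add: conflict_eq_weighted_gap weighted_gap_def sum.distrib[symmetric] algebra_simps)
    then show ?thesis using IH[of b] by (cases "agree_prob p i b = 0") (auto simp: algebra_simps)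
  qed
  \<comment> \<open>The root contributes the probability that the answers differ, the shift of the
    depths the probability that they agree; together they make the 1.\<close>
  have conf: "conflict (Query i T0 T1) p = 1 + (agree_prob p i False * conflict T0 (pair_cond p i False) +
      agree_prob p i True * conflict T1 (pair_cond p i True))"
    using *[of False] *[of True]
    by (simp add: conflict_eq_weighted_gap[of "Query i T0 T1"] weighted_gap_Query)
  have nn: "0 \<le> agree_prob p i b * conflict (?T b) (pair_cond p i b)" for b
    using IH[of b] by (cases "agree_prob p i b = 0") auto
  have eq: "ennreal (agree_prob p i b * conflict (?T b) (pair_cond p i b)) =
      ennreal (agree_prob p i b) * conflict_time (?T b) (pair_cond p i b)" for b
    using IH[of b] by (cases "agree_prob p i b = 0") (auto simp: ennreal_mult)
  have "conflict_time (Query i T0 T1) p = 1 +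
      (ennreal (agree_prob p i False) * conflict_time T0 (pair_cond p i False) +
       ennreal (agree_prob p i True) * conflict_time T1 (pair_cond p i True))"
    using pair_answer_integral[of p i "\<lambda>b. conflict_time (?T b) (pair_cond p i b)"] by simp
  then have "ennreal (conflict (Query i T0 T1) p) = conflict_time (Query i T0 T1) p"
    using nn[of False] nn[of True] eq[of False] eq[of True] by (simp add: conf)
  then show ?case using gap1 nn[of False] nn[of True] by (simp add: conf)
qed

section \<open>Trees computing \<open>g\<close> and finiteness of the max conflict
  complexity\<close>

text \<open>The tree queries all of \<open>I\<close>. Below the answer \<open>b\<close> at
  \<open>i\<close>, the function with this argument overwritten by \<open>b\<close> no longer
  depends on \<open>i\<close>.\<close>

lemma dtree_of_function:
  assumes "finite I" "\<And>x y. (\<And>i. i \<in> I \<Longrightarrow> x i = y i) \<Longrightarrow> h x = h y"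
  shows "\<exists>T\<in>dtrees I UNIV. \<forall>x. run T x = h x"
  using assms
proof (induction I arbitrary: h rule: finite_induct)
  case empty
  then show ?case by (intro bexI[of _ "Leaf (h undefined)"]) (auto simp: dtrees_def)
next
  case (insert i I)
  have "\<exists>T\<in>dtrees I UNIV. \<forall>x. run T x = h (x(i := b))" for b
    by (rule insert.IH) (auto intro!: insert.prems)
  then obtain T where T: "T b \<in> dtrees I UNIV" "run (T b) x = h (x(i := b))" for b x
    by metis
  have "run (Query i (T False) (T True)) x = h x" for x
    using T(2)[of "x i" x] by (cases "x i") (simp_all add: fun_upd_idem)
  moreover have "Query i (T False) (T True) \<in> dtrees (insert i I) UNIV"
    using T(1)[of True] T(1)[of False] by (auto simp: dtrees_def)
  ultimately show ?case by blast
qed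

lemma computing_trees_nonempty:
  assumes "finite I" "g \<subseteq> cube I \<times> UNIV"
  shows "computing_trees I g \<noteq> {}"
proof -
  \<comment> \<open>Elements of \<open>preim g True\<close> are extensional; restricting to
    \<open>I\<close> first makes the test depend on the values in \<open>I\<close> alone.\<close>
  have "\<exists>T\<in>dtrees I UNIV. \<forall>x. run T x = (restrict x I \<in> preim g True)"
    by (rule dtree_of_function[OF assms(1)]) (simp cong: restrict_cong)
  then obtain T where T: "T \<in> dtrees I UNIV" "\<And>x. run T x = (restrict x I \<in> preim g True)"
    by blast
  have "run T x = b" if "x \<in> preim g b" for x b
  proof -
    have "x \<in> cube I" using that assms(2) by (auto simp: preim_def)
    then have "restrict x I = x" by (auto simp: cube_def PiE_def extensional_restrict)
    then show ?thesis using that T(2)[of x] by (cases b) (auto simp: preim_def)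
  qed
  then show ?thesis using T(1) by (auto simp: computing_trees_def)
qed

lemma computing_trees_conflict:
  assumes "T \<in> computing_trees I g" "p \<in> input_pairs g"
  shows "0 \<le> conflict T p \<and> ennreal (conflict T p) = conflict_time T p"
proof -
  have "run T x = b" if "x \<in> preim g b" for x b
    using assms(1) that by (auto simp: computing_trees_def)
  then show ?thesis
    using conflict_eq_conflict_time[of p T] assms(2) by (fastforce simp: input_pairs_def)
qed

text \<open>The bound by the size of the tree makes \<open>conflict T\<close> integrable. From here
  on only nonnegative integrals occur, where sums and mixtures need no integrability.\<close>

lemma ennreal_expected_conflict:
  assumes "T \<in> computing_trees I g" "set_pmf Q \<subseteq> input_pairs g"
  shows "ennreal (expected_conflict T Q) = (\<integral>\<^sup>+ p. conflict_time T p \<partial>measure_pmf Q)"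
proof -
  have c: "AE p in measure_pmf Q. 0 \<le> conflict T p \<and> ennreal (conflict T p) = conflict_time T p"
    using computing_trees_conflict[OF assms(1)] assms(2) by (auto simp: AE_measure_pmf_iff)
  have "AE p in measure_pmf Q. norm (conflict T p) \<le> real (size T)"
    using c
  proof eventually_elim
    case (elim p)
    have "ennreal (conflict T p) \<le> ennreal (real (size T))"
      using elim conflict_time_le_size[of T p] by (simp add: ennreal_of_nat_eq_real_of_nat)
    then have "conflict T p \<le> real (size T)" by (rule ennreal_le_iff[THEN iffD1, rotated]) simp
    then show ?case using elim by simp
  qed
  then have "integrable (measure_pmf Q) (conflict T)"
    by (intro measure_pmf.integrable_const_bound) auto
  then have "(\<integral>\<^sup>+ p. ennreal (conflict T p) \<partial>measure_pmf Q) = ennreal (expected_conflict T Q)"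
    unfolding expected_conflict_def
    by (rule nn_integral_eq_integral) (use c in eventually_elim, simp)
  moreover have "(\<integral>\<^sup>+ p. ennreal (conflict T p) \<partial>measure_pmf Q) =
      (\<integral>\<^sup>+ p. conflict_time T p \<partial>measure_pmf Q)"
    by (rule nn_integral_cong_AE) (use c in eventually_elim, simp)
  ultimately show ?thesis by simp
qed

text \<open>The size of a single computing tree bounds the value for all \<open>Q\<close> at
  once.\<close>

lemma max_conflict_complexity_finite:
  assumes "finite I" "g \<subseteq> cube I \<times> UNIV"
  shows "max_conflict_complexity I g < \<top>"
proof -
  obtain T where T: "T \<in> computing_trees I g"
    using computing_trees_nonempty[OF assms] by blast
  have "max_conflict_complexity I g \<le> of_nat (size T)"
    unfolding max_conflict_complexity_def
  proof (rule SUP_least)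
    fix Q assume "Q \<in> {Q. set_pmf Q \<subseteq> input_pairs g}"
    then have "ennreal (expected_conflict T Q) = (\<integral>\<^sup>+ p. conflict_time T p \<partial>measure_pmf Q)"
      using ennreal_expected_conflict[OF T] by auto
    also have "\<dots> \<le> (\<integral>\<^sup>+ p. of_nat (size T) \<partial>measure_pmf Q)"
      by (intro nn_integral_mono conflict_time_le_size)
    finally show "(INF T\<in>computing_trees I g. ennreal (expected_conflict T Q)) \<le> of_nat (size T)"
      by (intro INF_lower2[OF T]) simp
  qed
  then show ?thesis using le_less_trans of_nat_less_top by blast
qed

section \<open>Nearly optimal distributions and the rate of conflicts\<close>

text \<open>The slack \<open>\<delta>\<close> avoids the question whether the supremum over
  \<open>Q\<close> is attained.\<close>

definition near_optimal ::
  "'i set \<Rightarrow> (('i \<Rightarrow> bool) \<times> bool) set \<Rightarrow> ennreal \<Rightarrow> 'i pmf_pair pmf \<Rightarrow> bool" where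
  "near_optimal I g \<delta> Q \<longleftrightarrow> set_pmf Q \<subseteq> input_pairs g \<and>
     (\<forall>T\<in>computing_trees I g. max_conflict_complexity I g \<le> ennreal (expected_conflict T Q) + \<delta>)"

lemma ex_near_optimal:
  assumes "finite I" "g \<subseteq> cube I \<times> UNIV" "0 < max_conflict_complexity I g" "0 < \<delta>"
  shows "\<exists>Q. near_optimal I g \<delta> Q"
proof -
  let ?X = "max_conflict_complexity I g"
  have "?X - \<delta> < ?X"
    using assms(3,4) max_conflict_complexity_finite[OF assms(1,2)] by (intro ennreal_between) auto
  then obtain Q where Q: "set_pmf Q \<subseteq> input_pairs g"
      "?X - \<delta> < (INF T\<in>computing_trees I g. ennreal (expected_conflict T Q))"
    by (subst (asm) (2) max_conflict_complexity_def) (auto simp: less_SUP_iff)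
  have "?X \<le> ennreal (expected_conflict T Q) + \<delta>" if "T \<in> computing_trees I g" for T
  proof -
    have "?X - \<delta> \<le> ennreal (expected_conflict T Q)"
      using less_le_trans[OF Q(2) INF_lower[OF that]] by simp
    then show ?thesis by (simp add: ennreal_minus_le_iff add.commute)
  qed
  then show ?thesis using Q(1) by (auto simp: near_optimal_def)
qed

text \<open>Continuing after \<open>U\<close> with a tree that is good for the conditional distribution of the
  surviving pairs yields a tree computing \<open>g\<close>; as \<open>Q\<close> is nearly worst possible, \<open>U\<close> cannot
  produce conflicts at a rate higher than \<open>1 / max_conflict_complexity I g\<close>.\<close>

lemma conflict_prob_le_conflict_time:
  assumes "finite I" "g \<subseteq> cube I \<times> UNIV" "near_optimal I g \<delta> Q" "0 < \<delta>" "query_indices U \<subseteq> I"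
  shows "max_conflict_complexity I g * (\<integral>\<^sup>+ p. ennreal (pmf (coupled_run U p) None) \<partial>measure_pmf Q)
    \<le> (\<integral>\<^sup>+ p. conflict_time U p \<partial>measure_pmf Q) + 2 * \<delta>"
proof -
  let ?X = "max_conflict_complexity I g"
  define W where "W = bind_pmf Q (coupled_run U)"
  define q where "q = pmf W None"
  have q: "0 \<le> q" "q \<le> 1" by (auto simp: q_def pmf_le_1)
  have Xfin: "?X < \<top>" by (rule max_conflict_complexity_finite[OF assms(1,2)])
  have Q: "set_pmf Q \<subseteq> input_pairs g" using assms(3) by (simp add: near_optimal_def)
  have confl: "(\<integral>\<^sup>+ p. ennreal (pmf (coupled_run U p) None) \<partial>measure_pmf Q) = ennreal q"
    by (simp add: q_def W_def ennreal_pmf_bind)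
  let ?E = "\<lambda>T. \<integral>\<^sup>+ r. (case r of None \<Rightarrow> 0 | Some p' \<Rightarrow> conflict_time T p') \<partial>measure_pmf W"
  \<comment> \<open>\<open>graft U T\<close> computes \<open>g\<close> because \<open>T\<close>
    does, so near-optimality of \<open>Q\<close> bounds its expected conflict from below.\<close>
  have total: "?X \<le> (\<integral>\<^sup>+ p. conflict_time U p \<partial>measure_pmf Q) + ?E T + \<delta>"
    if T: "T \<in> computing_trees I g" for T
  proof -
    have G: "graft U T \<in> computing_trees I g"
      using T assms(5) by (auto simp: computing_trees_def intro: graft_in_dtrees)
    have "?X \<le> ennreal (expected_conflict (graft U T) Q) + \<delta>"
      using assms(3) G by (auto simp: near_optimal_def)
    also have "ennreal (expected_conflict (graft U T) Q) =
        (\<integral>\<^sup>+ p. conflict_time U p \<partial>measure_pmf Q) + ?E T"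
      by (simp add: ennreal_expected_conflict[OF G Q] conflict_time_graft W_def nn_integral_add)
    finally show ?thesis .
  qed
  have "\<exists>T\<in>computing_trees I g. ?E T \<le> ennreal (1 - q) * (?X + \<delta>)"
  proof (cases "set_pmf W \<inter> {r. r \<noteq> None} = {}")
    case True
    \<comment> \<open>Every pair has met a conflict within \<open>U\<close>, so any computing tree
      adds nothing.\<close>
    obtain T where "T \<in> computing_trees I g"
      using computing_trees_nonempty[OF assms(1,2)] by blast
    moreover have "?E T = (\<integral>\<^sup>+ r. 0 \<partial>measure_pmf W)"
      using True by (intro nn_integral_cong_AE) (auto simp: AE_measure_pmf_iff disjoint_iff split: option.split)
    ultimately show ?thesis by (intro bexI[of _ T]) simp_all
  next
    case False
    let ?S = "{r :: 'a pmf_pair option. r \<noteq> None}"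
    \<comment> \<open>\<open>Q'\<close> is the conditional distribution of the surviving pairs. Its
      value is at most that of the supremum, so some tree does well against it.\<close>
    define Q' where "Q' = map_pmf the (cond_pmf W ?S)"
    have S: "measure_pmf.prob W ?S = 1 - q"
    proof -
      have "?S = UNIV - {None}" by auto
      then show ?thesis using measure_pmf.prob_compl[of "{None}" W]
        by (simp add: q_def measure_pmf_single)
    qed
    have "emeasure (measure_pmf W) ?S \<noteq> 0"
      using False by (simp add: emeasure_measure_pmf_not_zero)
    then have q1: "1 - q > 0" using S q by (simp add: measure_pmf.emeasure_eq_measure)
    have Q': "set_pmf Q' \<subseteq> input_pairs g"
    proof
      fix p' assume "p' \<in> set_pmf Q'"
      then obtain r where "r \<in> set_pmf W" "r \<noteq> None" "p' = the r"
        using False by (auto simp: Q'_def)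
      then have "Some p' \<in> set_pmf W" by auto
      then obtain p where "p \<in> set_pmf Q" "Some p' \<in> set_pmf (coupled_run U p)"
        by (auto simp: W_def)
      then show "p' \<in> input_pairs g" using coupled_run_input_pairs Q by blast
    qed
    then have "(INF T\<in>computing_trees I g. ennreal (expected_conflict T Q')) \<le> ?X"
      unfolding max_conflict_complexity_def by (intro SUP_upper) simp
    \<comment> \<open>This is the source of the second \<open>\<delta>\<close>: a tree is chosen
      strictly below \<open>?X + \<delta>\<close>, without a minimum over trees.\<close>
    also have "\<dots> < ?X + \<delta>" using ennreal_add_left_cancel_less[of ?X 0 \<delta>] Xfin assms(4) by auto
    finally obtain T where T: "T \<in> computing_trees I g" "ennreal (expected_conflict T Q') < ?X + \<delta>"
      by (auto simp: INF_less_iff)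
    have "(\<integral>\<^sup>+ p. conflict_time T p \<partial>measure_pmf Q') =
        (\<integral>\<^sup>+ r. conflict_time T (the r) * indicator ?S r \<partial>measure_pmf W) / ennreal (1 - q)"
      using False
      by (simp add: Q'_def cond_pmf.rep_eq nn_integral_uniform_measure S[symmetric]
          measure_pmf.emeasure_eq_measure)
    moreover have "(\<integral>\<^sup>+ r. conflict_time T (the r) * indicator ?S r \<partial>measure_pmf W) = ?E T"
      by (intro nn_integral_cong) (auto split: option.split)
    ultimately have "?E T / ennreal (1 - q) < ?X + \<delta>"
      using T(2) ennreal_expected_conflict[OF T(1) Q'] by simp
    then have "ennreal (1 - q) * (?E T / ennreal (1 - q)) \<le> ennreal (1 - q) * (?X + \<delta>)"
      by (intro mult_left_mono) auto
    then have "?E T \<le> ennreal (1 - q) * (?X + \<delta>)"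
      using q1 by (simp add: ennreal_times_divide mult.commute[of "ennreal (1 - q)" "?E T"]
          ennreal_mult_divide_eq)
    then show ?thesis using T(1) by blast
  qed
  then obtain T where T: "T \<in> computing_trees I g" "?E T \<le> ennreal (1 - q) * (?X + \<delta>)" by blast
  \<comment> \<open>The surviving part \<open>?X * (1 - q)\<close> is finite and cancels against the
    cost of the continuation, leaving \<open>?X * q\<close> on the left.\<close>
  have "?X * ennreal q + ?X * ennreal (1 - q) = ?X"
    using q by (simp flip: distrib_left ennreal_plus)
  also have "\<dots> \<le> (\<integral>\<^sup>+ p. conflict_time U p \<partial>measure_pmf Q) + ?E T + \<delta>" by (rule total[OF T(1)])
  also have "\<dots> \<le> (\<integral>\<^sup>+ p. conflict_time U p \<partial>measure_pmf Q) + (?X * ennreal (1 - q) + \<delta>) + \<delta>"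
  proof -
    have "ennreal (1 - q) * \<delta> \<le> 1 * \<delta>" using q by (intro mult_right_mono) auto
    then have "?E T \<le> ?X * ennreal (1 - q) + \<delta>"
      using T(2) by (simp add: distrib_left mult.commute) (meson add_left_mono order_trans)
    then show ?thesis by (intro add_mono) auto
  qed
  finally have "?X * ennreal (1 - q) + ?X * ennreal q \<le>
      ?X * ennreal (1 - q) + ((\<integral>\<^sup>+ p. conflict_time U p \<partial>measure_pmf Q) + 2 * \<delta>)"
    by (simp add: add_ac mult_2)
  moreover have "?X * ennreal (1 - q) < \<top>" using Xfin by (simp add: ennreal_mult_less_top)
  ultimately show ?thesis by (auto simp: confl ennreal_add_left_cancel_le)
qed

section \<open>Simulation of one block by a single variable\<close>

text \<open>The partial map \<open>\<beta>\<close> singles out the variables of one block and gives their position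
  in it.\<close>

definition merge :: "('j \<Rightarrow> 'i option) \<Rightarrow> ('j \<Rightarrow> bool) \<Rightarrow> ('i \<Rightarrow> bool) \<Rightarrow> 'j \<Rightarrow> bool" where
  "merge \<beta> y x j = (case \<beta> j of None \<Rightarrow> y j | Some i \<Rightarrow> x i)"

lemma merge_None: "\<beta> j = None \<Longrightarrow> merge \<beta> y x j = y j"
  and merge_Some: "\<beta> j = Some i \<Longrightarrow> merge \<beta> y x j = x i"
  by (simp_all add: merge_def)

fun fix_block :: "('j \<Rightarrow> 'i option) \<Rightarrow> ('i \<Rightarrow> bool) \<Rightarrow> ('j, 'a) dtree \<Rightarrow> ('j, 'a) dtree" where
  "fix_block \<beta> x (Leaf a) = Leaf a"
| "fix_block \<beta> x (Query j T0 T1) = (case \<beta> j of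
     None \<Rightarrow> Query j (fix_block \<beta> x T0) (fix_block \<beta> x T1)
   | Some i \<Rightarrow> fix_block \<beta> x (if x i then T1 else T0))"

text \<open>The tree on one block that remains when the other variables are answered from
  \<open>y\<close>; the bound on the rate of conflicts is applied to it.\<close>

fun fix_rest :: "('j \<Rightarrow> 'i option) \<Rightarrow> ('j \<Rightarrow> bool) \<Rightarrow> ('j, 'a) dtree \<Rightarrow> ('i, 'a) dtree" where
  "fix_rest \<beta> y (Leaf a) = Leaf a"
| "fix_rest \<beta> y (Query j T0 T1) = (case \<beta> j of
     None \<Rightarrow> fix_rest \<beta> y (if y j then T1 else T0)
   | Some i \<Rightarrow> Query i (fix_rest \<beta> y T0) (fix_rest \<beta> y T1))"

text \<open>Weights are needed because a query to a variable of \<open>f\<close> is worth as much as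
  many queries to a block.\<close>

fun cost :: "('j \<Rightarrow> ennreal) \<Rightarrow> ('j, 'a) dtree \<Rightarrow> ('j \<Rightarrow> bool) \<Rightarrow> ennreal" where
  "cost w (Leaf a) y = 0"
| "cost w (Query j T0 T1) y = w j + cost w (if y j then T1 else T0) y"

text \<open>The block is sampled along the coupled process; the variable \<open>\<zeta>\<close>, which tells from which
  of the two distributions to sample, is queried only when the two samples differ.\<close>

fun simulate :: "('j \<Rightarrow> 'i option) \<Rightarrow> 'j \<Rightarrow> ('j, 'a) dtree \<Rightarrow> 'i pmf_pair \<Rightarrow> ('j, 'a) dtree pmf" where
  "simulate \<beta> \<zeta> (Leaf a) p = return_pmf (Leaf a)"
| "simulate \<beta> \<zeta> (Query j T0 T1) p = (case \<beta> j of
     None \<Rightarrow> bind_pmf (simulate \<beta> \<zeta> T0 p) (\<lambda>t0. map_pmf (Query j t0) (simulate \<beta> \<zeta> T1 p))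
   | Some i \<Rightarrow> bind_pmf (pair_answer p i) (\<lambda>c.
       if fst c = snd c then simulate \<beta> \<zeta> (if fst c then T1 else T0) (pair_cond p i (fst c))
       else bind_pmf (pcond (fst p) i (fst c)) (\<lambda>x0. map_pmf (\<lambda>x1.
         Query \<zeta> (fix_block \<beta> x0 (if fst c then T1 else T0)) (fix_block \<beta> x1 (if snd c then T1 else T0)))
         (pcond (snd p) i (snd c)))))"

definition pick :: "bool \<Rightarrow> 'c \<times> 'c \<Rightarrow> 'c" where
  "pick b c = (if b then snd c else fst c)"

lemma pick_True: "pick True = snd" and pick_False: "pick False = fst"
  by (simp_all add: pick_def fun_eq_iff)

lemma run_fix_block: "run (fix_block \<beta> x T) y = run T (merge \<beta> y x)"
  by (induction T) (auto simp: merge_def split: option.split)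

lemma cost_fix_block_le: "cost w (fix_block \<beta> x T) y \<le> cost w T (merge \<beta> y x)"
  by (induction T) (auto simp: merge_def add_increasing add_left_mono split: option.split)

lemma fix_block_indices:
  "query_indices (fix_block \<beta> x T) \<subseteq> query_indices T - {j. \<beta> j \<noteq> None}"
  "outputs (fix_block \<beta> x T) \<subseteq> outputs T"
  by (induction T) (auto split: option.splits)

lemma fix_rest_indices: "query_indices (fix_rest \<beta> y T) \<subseteq> {i. \<exists>j\<in>query_indices T. \<beta> j = Some i}"
  by (induction T) (auto split: option.splits)

lemma simulate_indices:
  assumes "t \<in> set_pmf (simulate \<beta> \<zeta> T p)"
  shows "query_indices t \<subseteq> insert \<zeta> (query_indices T - {j. \<beta> j \<noteq> None}) \<and> outputs t \<subseteq> outputs T"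
  using assms
proof (induction T arbitrary: t p)
  case (Query j T0 T1)
  show ?case
  proof (cases "\<beta> j")
    case None
    then obtain t0 t1 where "t = Query j t0 t1" "t0 \<in> set_pmf (simulate \<beta> \<zeta> T0 p)"
        "t1 \<in> set_pmf (simulate \<beta> \<zeta> T1 p)"
      using Query.prems by auto
    then show ?thesis using Query.IH(1)[of t0 p] Query.IH(2)[of t1 p] None by auto
  next
    case (Some i)
    then obtain c where c: "t \<in> set_pmf (if fst c = snd c
        then simulate \<beta> \<zeta> (if fst c then T1 else T0) (pair_cond p i (fst c))
        else bind_pmf (pcond (fst p) i (fst c)) (\<lambda>x0. map_pmf (\<lambda>x1.
         Query \<zeta> (fix_block \<beta> x0 (if fst c then T1 else T0)) (fix_block \<beta> x1 (if snd c then T1 else T0)))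
         (pcond (snd p) i (snd c))))"
      using Query.prems by (simp only: simulate.simps option.case set_bind_pmf UN_iff) blast
    show ?thesis
    proof (cases "fst c = snd c")
      case True
      then show ?thesis
        using c Query.IH(1)[of t "pair_cond p i (fst c)"] Query.IH(2)[of t "pair_cond p i (fst c)"]
        by (cases "fst c") auto
    next
      case False
      then obtain x0 x1 where "t = Query \<zeta> (fix_block \<beta> x0 (if fst c then T1 else T0))
          (fix_block \<beta> x1 (if snd c then T1 else T0))"
        using c by auto
      then show ?thesis
        using fix_block_indices[of \<beta> x0 "if fst c then T1 else T0"]
          fix_block_indices[of \<beta> x1 "if snd c then T1 else T0"]
        by (auto split: if_splits)
    qed
  qed
qed auto

text \<open>The coupling has the right marginals, so for each component on its own coupled sampling
  is ordinary lazy sampling.\<close>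

lemma bind_pair_answer:
  "bind_pmf (pair_answer p i) (\<lambda>c. pcond (pick b p) i (pick b c)) = pick b p"
proof -
  have "map_pmf (pick b) (pair_answer p i) = answer (pick b p) i"
    by (cases b) (simp_all add: pick_True pick_False pair_answer_def map_coupling)
  then have "bind_pmf (pair_answer p i) (\<lambda>c. pcond (pick b p) i (pick b c)) =
      bind_pmf (answer (pick b p) i) (pcond (pick b p) i)"
    by (metis (no_types, lifting) bind_map_pmf bind_pmf_cong)
  then show ?thesis by (simp add: bind_answer_pcond)
qed

lemma pcond_pair_answer:
  assumes "c \<in> set_pmf (pair_answer p i)" "x \<in> set_pmf (pcond (pick b p) i (pick b c))"
  shows "x i = pick b c"
proof (rule set_pcond_answer[OF _ assms(2)])
  show "pick b c \<in> set_pmf (answer (pick b p) i)"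
    using set_coupling assms(1) by (auto simp: pick_def pair_answer_def)
qed

lemma pick_pair_cond: "pick b (pair_cond p i d) = pcond (pick b p) i d"
  by (simp add: pick_def pair_cond_def)

lemma pick_eq: "fst c = snd c \<Longrightarrow> pick b c = fst c"
  by (simp add: pick_def)

text \<open>Agreeing answers serve both components, and at the first difference the value of
  \<open>\<zeta>\<close> tells which of the two conditional samples to use. Either way the block is
  a genuine sample from the component selected by \<open>y \<zeta>\<close>.\<close>

lemma run_simulate:
  "map_pmf (\<lambda>t. run t y) (simulate \<beta> \<zeta> T p) = map_pmf (\<lambda>x. run T (merge \<beta> y x)) (pick (y \<zeta>) p)"
proof (induction T arbitrary: p)
  case (Query j T0 T1)
  let ?T = "\<lambda>b. if b then T1 else T0"
  show ?case
  proof (cases "\<beta> j")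
    case None
    \<comment> \<open>Both subtrees are drawn independently; the one that \<open>y\<close> does not
      enter integrates out.\<close>
    have "map_pmf (\<lambda>t. run t y) (simulate \<beta> \<zeta> (Query j T0 T1) p) =
        map_pmf (\<lambda>t. run t y) (simulate \<beta> \<zeta> (?T (y j)) p)"
      by (cases "y j") (simp_all add: None map_bind_pmf map_pmf_comp bind_pmf_const flip: map_pmf_def)
    also have "\<dots> = map_pmf (\<lambda>x. run (?T (y j)) (merge \<beta> y x)) (pick (y \<zeta>) p)"
      using Query.IH by (cases "y j") auto
    finally show ?thesis using None by (simp add: merge_None)
  next
    case (Some i)
    let ?b = "y \<zeta>"
    have "map_pmf (\<lambda>x. run (Query j T0 T1) (merge \<beta> y x)) (pick ?b p) =
        bind_pmf (pair_answer p i) (\<lambda>c. map_pmf (\<lambda>x. run (Query j T0 T1) (merge \<beta> y x))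
          (pcond (pick ?b p) i (pick ?b c)))"
      by (subst (1) bind_pair_answer[of p i ?b, symmetric]) (simp only: map_bind_pmf)
    \<comment> \<open>Almost surely the conditioned sample has the drawn answer at \<open>i\<close>,
      which determines the branch.\<close>
    also have "\<dots> = bind_pmf (pair_answer p i) (\<lambda>c. map_pmf (\<lambda>x. run (?T (pick ?b c)) (merge \<beta> y x))
          (pcond (pick ?b p) i (pick ?b c)))"
      by (intro bind_pmf_cong map_pmf_cong refl) (simp add: merge_Some Some pcond_pair_answer)
    also have "\<dots> = map_pmf (\<lambda>t. run t y) (simulate \<beta> \<zeta> (Query j T0 T1) p)"
    proof -
      have "map_pmf (\<lambda>x. run (?T (pick ?b c)) (merge \<beta> y x)) (pcond (pick ?b p) i (pick ?b c)) =
        map_pmf (\<lambda>t. run t y) (if fst c = snd c then simulate \<beta> \<zeta> (?T (fst c)) (pair_cond p i (fst c))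
          else bind_pmf (pcond (fst p) i (fst c)) (\<lambda>x0. map_pmf (\<lambda>x1.
            Query \<zeta> (fix_block \<beta> x0 (?T (fst c))) (fix_block \<beta> x1 (?T (snd c))))
            (pcond (snd p) i (snd c))))" for c
      proof (cases "fst c = snd c")
        case True
        then show ?thesis
          using Query.IH[of "pair_cond p i (fst c)"] by (cases "fst c") (simp_all add: pick_eq pick_pair_cond)
      next
        case False
        \<comment> \<open>The sample for the component not selected by \<open>y \<zeta>\<close>
          integrates out.\<close>
        then show ?thesis
          by (cases ?b) (simp_all add: map_bind_pmf map_pmf_comp run_fix_block pick_def bind_pmf_const
              flip: map_pmf_def)
      qed
      then show ?thesis using Some by (simp add: map_bind_pmf)
    qed
    finally show ?thesis by simp
  qed
qed auto

text \<open>Queries to the block up to the first conflict cost 1 each in \<open>T\<close> and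
  nothing in the simulation; \<open>conflict_time\<close> is their expected number. In exchange the
  simulation pays \<open>w \<zeta>\<close> at a conflict. Slack arises only from later queries to
  the block, which are free as well. The saving is written as a summand on the left to avoid
  subtraction in \<open>ennreal\<close>.\<close>

lemma cost_simulate:
  assumes "\<And>j. \<beta> j \<noteq> None \<Longrightarrow> w j = 1"
  shows "(\<integral>\<^sup>+ t. cost w t y \<partial>measure_pmf (simulate \<beta> \<zeta> T p)) + conflict_time (fix_rest \<beta> y T) p \<le>
    (\<integral>\<^sup>+ x. cost w T (merge \<beta> y x) \<partial>measure_pmf (pick (y \<zeta>) p)) +
    w \<zeta> * ennreal (pmf (coupled_run (fix_rest \<beta> y T) p) None)"
proof (induction T arbitrary: p)
  case (Query j T0 T1)
  let ?T = "\<lambda>b. if b then T1 else T0"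
  show ?case
  proof (cases "\<beta> j")
    case None
    have "(\<integral>\<^sup>+ t. cost w t y \<partial>measure_pmf (simulate \<beta> \<zeta> (Query j T0 T1) p)) =
        w j + (\<integral>\<^sup>+ t. cost w t y \<partial>measure_pmf (simulate \<beta> \<zeta> (?T (y j)) p))"
      by (cases "y j") (simp_all add: None nn_integral_add)
    moreover have "(\<integral>\<^sup>+ x. cost w (Query j T0 T1) (merge \<beta> y x) \<partial>measure_pmf (pick (y \<zeta>) p)) =
        w j + (\<integral>\<^sup>+ x. cost w (?T (y j)) (merge \<beta> y x) \<partial>measure_pmf (pick (y \<zeta>) p))"
      by (simp add: merge_None None nn_integral_add)
    moreover have "fix_rest \<beta> y (Query j T0 T1) = fix_rest \<beta> y (?T (y j))"
      using None by simp
    moreover have "(\<integral>\<^sup>+ t. cost w t y \<partial>measure_pmf (simulate \<beta> \<zeta> (?T (y j)) p)) +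
        conflict_time (fix_rest \<beta> y (?T (y j))) p \<le>
      (\<integral>\<^sup>+ x. cost w (?T (y j)) (merge \<beta> y x) \<partial>measure_pmf (pick (y \<zeta>) p)) +
        w \<zeta> * ennreal (pmf (coupled_run (fix_rest \<beta> y (?T (y j))) p) None)"
      using Query.IH by (cases "y j") auto
    ultimately show ?thesis
      by (simp only: add.assoc) (rule add_left_mono)
  next
    case (Some i)
    let ?b = "y \<zeta>"
    let ?F = "\<lambda>b. fix_rest \<beta> y (?T b)"
    let ?S = "\<lambda>c. if fst c = snd c then simulate \<beta> \<zeta> (?T (fst c)) (pair_cond p i (fst c))
          else bind_pmf (pcond (fst p) i (fst c)) (\<lambda>x0. map_pmf (\<lambda>x1.
            Query \<zeta> (fix_block \<beta> x0 (?T (fst c))) (fix_block \<beta> x1 (?T (snd c))))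
            (pcond (snd p) i (snd c)))"
    let ?t = "\<lambda>c. if fst c = snd c then conflict_time (?F (fst c)) (pair_cond p i (fst c)) else 0"
    let ?n = "\<lambda>c. pmf (if fst c = snd c then coupled_run (?F (fst c)) (pair_cond p i (fst c))
        else return_pmf None) None"
    let ?C = "\<lambda>c. \<integral>\<^sup>+ x. cost w (?T (pick ?b c)) (merge \<beta> y x) \<partial>measure_pmf (pcond (pick ?b p) i (pick ?b c))"
    have F: "fix_rest \<beta> y (Query j T0 T1) = Query i (?F False) (?F True)" using Some by simp
    have F': "(if b then ?F True else ?F False) = ?F b" for b by simp
    have step: "(\<integral>\<^sup>+ t. cost w t y \<partial>measure_pmf (?S c)) + ?t c \<le> ?C c + w \<zeta> * ennreal (?n c)" for c
    proof (cases "fst c = snd c")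
      case True
      then show ?thesis
        using Query.IH[of "pair_cond p i (fst c)"] by (cases "fst c") (simp_all add: pick_eq pick_pair_cond)
    next
      case False
      have "(\<integral>\<^sup>+ t. cost w t y \<partial>measure_pmf (?S c)) = w \<zeta> +
          (\<integral>\<^sup>+ x. cost w (fix_block \<beta> x (?T (pick ?b c))) y \<partial>measure_pmf (pcond (pick ?b p) i (pick ?b c)))"
        using False by (cases ?b) (simp_all add: pick_def nn_integral_add)
      \<comment> \<open>After the conflict the block is fixed, so its queries drop out of the
        cost.\<close>
      also have "\<dots> \<le> w \<zeta> + ?C c"
        by (intro add_left_mono nn_integral_mono cost_fix_block_le)
      also have "\<dots> = ?C c + w \<zeta> * ennreal (?n c)" using False by (simp add: add.commute)
      finally have le: "(\<integral>\<^sup>+ t. cost w t y \<partial>measure_pmf (?S c)) \<le> ?C c + w \<zeta> * ennreal (?n c)" .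
      have "?t c = 0" using False by simp
      then show ?thesis using le by (simp only: add_0_right)
    qed
    \<comment> \<open>The 1 stands for the present query to the block: on this side it comes from
      \<open>conflict_time\<close>, on the other from \<open>w j = 1\<close>.\<close>
    have "(\<integral>\<^sup>+ t. cost w t y \<partial>measure_pmf (simulate \<beta> \<zeta> (Query j T0 T1) p)) +
        conflict_time (fix_rest \<beta> y (Query j T0 T1)) p =
      1 + (\<integral>\<^sup>+ c. (\<integral>\<^sup>+ t. cost w t y \<partial>measure_pmf (?S c)) + ?t c \<partial>measure_pmf (pair_answer p i))"
      unfolding F conflict_time.simps F'
      by (subst nn_integral_add) (simp_all add: Some add_ac)
    also have "\<dots> \<le> 1 + (\<integral>\<^sup>+ c. ?C c + w \<zeta> * ennreal (?n c) \<partial>measure_pmf (pair_answer p i))"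
      by (intro add_left_mono nn_integral_mono step)
    also have "\<dots> = (1 + (\<integral>\<^sup>+ c. ?C c \<partial>measure_pmf (pair_answer p i))) +
        w \<zeta> * ennreal (pmf (coupled_run (fix_rest \<beta> y (Query j T0 T1)) p) None)"
      unfolding F coupled_run.simps F'
      by (subst nn_integral_add) (simp_all add: nn_integral_cmult ennreal_pmf_bind add_ac)
    also have "1 + (\<integral>\<^sup>+ c. ?C c \<partial>measure_pmf (pair_answer p i)) =
        (\<integral>\<^sup>+ c. (\<integral>\<^sup>+ x. cost w (Query j T0 T1) (merge \<beta> y x)
          \<partial>measure_pmf (pcond (pick ?b p) i (pick ?b c))) \<partial>measure_pmf (pair_answer p i))"
    proof -
      have "(\<integral>\<^sup>+ x. cost w (Query j T0 T1) (merge \<beta> y x) \<partial>measure_pmf (pcond (pick ?b p) i (pick ?b c))) =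
          1 + ?C c" if "c \<in> set_pmf (pair_answer p i)" for c
      proof -
        have "(\<integral>\<^sup>+ x. cost w (Query j T0 T1) (merge \<beta> y x) \<partial>measure_pmf (pcond (pick ?b p) i (pick ?b c))) =
          (\<integral>\<^sup>+ x. 1 + cost w (?T (pick ?b c)) (merge \<beta> y x) \<partial>measure_pmf (pcond (pick ?b p) i (pick ?b c)))"
          using assms[of j]
          by (intro nn_integral_cong_AE, unfold AE_measure_pmf_iff, intro ballI)
            (simp add: merge_Some Some pcond_pair_answer[OF that])
        then show ?thesis by (simp add: nn_integral_add)
      qed
      then have "(\<integral>\<^sup>+ c. (\<integral>\<^sup>+ x. cost w (Query j T0 T1) (merge \<beta> y x)
          \<partial>measure_pmf (pcond (pick ?b p) i (pick ?b c))) \<partial>measure_pmf (pair_answer p i)) =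
          (\<integral>\<^sup>+ c. 1 + ?C c \<partial>measure_pmf (pair_answer p i))"
        by (intro nn_integral_cong_AE) (simp only: AE_measure_pmf_iff, blast)
      then show ?thesis by (simp add: nn_integral_add)
    qed
    also have "\<dots> = (\<integral>\<^sup>+ x. cost w (Query j T0 T1) (merge \<beta> y x)
        \<partial>measure_pmf (bind_pmf (pair_answer p i) (\<lambda>c. pcond (pick ?b p) i (pick ?b c))))"
      by (simp only: nn_integral_bind_pmf)
    also have "\<dots> = (\<integral>\<^sup>+ x. cost w (Query j T0 T1) (merge \<beta> y x) \<partial>measure_pmf (pick ?b p))"
      by (simp only: bind_pair_answer)
    finally show ?thesis .
  qed
qed auto

section \<open>Averaging the simulation over \<open>Q\<close>\<close>

text \<open>Both sides are integrals over the product pmf, up to swapping its components.\<close>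

lemma nn_integral_pmf_commute:
  "(\<integral>\<^sup>+ a. \<integral>\<^sup>+ b. h a b \<partial>measure_pmf B \<partial>measure_pmf A) =
   (\<integral>\<^sup>+ b. \<integral>\<^sup>+ a. h a b \<partial>measure_pmf A \<partial>measure_pmf B)"
proof -
  have "(\<integral>\<^sup>+ a. \<integral>\<^sup>+ b. h a b \<partial>measure_pmf B \<partial>measure_pmf A) =
      (\<integral>\<^sup>+ c. h (fst c) (snd c) \<partial>measure_pmf (pair_pmf A B))"
    by (simp add: nn_integral_pair_pmf')
  also have "\<dots> = (\<integral>\<^sup>+ c. h (snd c) (fst c) \<partial>measure_pmf (pair_pmf B A))"
    by (subst pair_commute_pmf) (simp add: case_prod_unfold)
  also have "\<dots> = (\<integral>\<^sup>+ b. \<integral>\<^sup>+ a. h a b \<partial>measure_pmf A \<partial>measure_pmf B)"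
    by (simp add: nn_integral_pair_pmf')
  finally show ?thesis .
qed

lemma run_simulate_mixture:
  "(\<integral>\<^sup>+ t. h (run t y) \<partial>measure_pmf (bind_pmf Q (simulate \<beta> \<zeta> T))) =
   (\<integral>\<^sup>+ u. h (run T (merge \<beta> y u)) \<partial>measure_pmf (bind_pmf Q (pick (y \<zeta>))))"
proof -
  have "(\<integral>\<^sup>+ t. h (run t y) \<partial>measure_pmf (simulate \<beta> \<zeta> T p)) =
      (\<integral>\<^sup>+ u. h (run T (merge \<beta> y u)) \<partial>measure_pmf (pick (y \<zeta>) p))" for p
  proof -
    have "(\<integral>\<^sup>+ t. h (run t y) \<partial>measure_pmf (simulate \<beta> \<zeta> T p)) =
        (\<integral>\<^sup>+ s. h s \<partial>measure_pmf (map_pmf (\<lambda>t. run t y) (simulate \<beta> \<zeta> T p)))"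
      by simp
    also have "\<dots> = (\<integral>\<^sup>+ u. h (run T (merge \<beta> y u)) \<partial>measure_pmf (pick (y \<zeta>) p))"
      by (simp add: run_simulate)
    finally show ?thesis .
  qed
  then show ?thesis by simp
qed

text \<open>As \<open>y\<close> is fixed, \<open>fix_rest \<beta> y T\<close> is one tree for all
  pairs, so the bound on the rate of conflicts applies: the charge for \<open>\<zeta>\<close> is at
  most the expected conflict time plus \<open>2 * \<delta>\<close>. The conflict time is finite and
  cancels.\<close>

lemma cost_simulate_mixture:
  assumes "finite I" "g \<subseteq> cube I \<times> UNIV" "near_optimal I g \<delta> Q" "0 < \<delta>"
    and "\<And>j. \<beta> j \<noteq> None \<Longrightarrow> w j = 1" "w \<zeta> = max_conflict_complexity I g"
    and "\<And>j i. j \<in> query_indices T \<Longrightarrow> \<beta> j = Some i \<Longrightarrow> i \<in> I"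
  shows "(\<integral>\<^sup>+ t. cost w t y \<partial>measure_pmf (bind_pmf Q (simulate \<beta> \<zeta> T))) \<le>
   (\<integral>\<^sup>+ u. cost w T (merge \<beta> y u) \<partial>measure_pmf (bind_pmf Q (pick (y \<zeta>)))) + 2 * \<delta>"
proof -
  let ?U = "fix_rest \<beta> y T"
  let ?C = "\<integral>\<^sup>+ p. conflict_time ?U p \<partial>measure_pmf Q"
  let ?L = "\<integral>\<^sup>+ t. cost w t y \<partial>measure_pmf (bind_pmf Q (simulate \<beta> \<zeta> T))"
  let ?R = "\<integral>\<^sup>+ u. cost w T (merge \<beta> y u) \<partial>measure_pmf (bind_pmf Q (pick (y \<zeta>)))"
  have U: "query_indices ?U \<subseteq> I" using fix_rest_indices[of \<beta> y T] assms(7) by blast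
  have "?C \<le> (\<integral>\<^sup>+ p. of_nat (size ?U) \<partial>measure_pmf Q)"
    by (intro nn_integral_mono conflict_time_le_size)
  then have fin: "?C \<noteq> \<top>" by (auto simp: top_unique)
  have "?L + ?C = (\<integral>\<^sup>+ p. (\<integral>\<^sup>+ t. cost w t y \<partial>measure_pmf (simulate \<beta> \<zeta> T p)) + conflict_time ?U p \<partial>measure_pmf Q)"
    by (simp add: nn_integral_add)
  also have "\<dots> \<le> (\<integral>\<^sup>+ p. (\<integral>\<^sup>+ x. cost w T (merge \<beta> y x) \<partial>measure_pmf (pick (y \<zeta>) p)) +
      w \<zeta> * ennreal (pmf (coupled_run ?U p) None) \<partial>measure_pmf Q)"
    by (intro nn_integral_mono cost_simulate assms(5))
  also have "\<dots> = ?R + w \<zeta> * (\<integral>\<^sup>+ p. ennreal (pmf (coupled_run ?U p) None) \<partial>measure_pmf Q)"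
    by (simp add: nn_integral_add nn_integral_cmult)
  also have "\<dots> \<le> ?R + (?C + 2 * \<delta>)"
    unfolding assms(6) by (intro add_left_mono conflict_prob_le_conflict_time assms U)
  finally have "?C + ?L \<le> ?C + (?R + 2 * \<delta>)" by (simp add: add_ac)
  then show ?thesis using fin by (auto simp: ennreal_add_left_cancel_le)
qed

section \<open>Truncation and hybrid trees\<close>

fun truncate :: "nat \<Rightarrow> 'a \<Rightarrow> ('i, 'a) dtree \<Rightarrow> ('i, 'a) dtree" where
  "truncate K s (Leaf a) = Leaf a"
| "truncate 0 s (Query i T0 T1) = Leaf s"
| "truncate (Suc K) s (Query i T0 T1) = Query i (truncate K s T0) (truncate K s T1)"

lemma num_queries_truncate: "num_queries (truncate K s T) x \<le> K"
  by (induction K s T rule: truncate.induct) auto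

lemma run_truncate: "num_queries T x \<le> K \<Longrightarrow> run (truncate K s T) x = run T x"
  by (induction K s T rule: truncate.induct) (auto split: if_splits)

lemma truncate_in_dtrees: "T \<in> dtrees I S \<Longrightarrow> s \<in> S \<Longrightarrow> truncate K s T \<in> dtrees I S"
  by (induction K s T rule: truncate.induct) (auto simp: dtrees_def)

text \<open>In hybrid trees \<open>Inl i\<close> is the \<open>i\<close>-th variable of \<open>f\<close> and \<open>Inr (i, j)\<close> the \<open>j\<close>-th variable
  of the \<open>i\<close>-th copy of \<open>g\<close>.\<close>

definition in_block :: "nat \<Rightarrow> nat + nat \<times> nat \<Rightarrow> nat option" where
  "in_block k = case_sum (\<lambda>_. None) (\<lambda>(i, l). if i = k then Some l else None)"

text \<open>With these weights, replacing a block raises the expected cost by at most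
  \<open>2 * \<delta>\<close>.\<close>

definition query_weight :: "ennreal \<Rightarrow> nat + nat \<times> nat \<Rightarrow> ennreal" where
  "query_weight X = case_sum (\<lambda>_. X) (\<lambda>_. 1)"

text \<open>Step \<open>k\<close> trades the queries to block \<open>k\<close> for queries to
  \<open>Inl k\<close>, with a fresh pair from \<open>Q\<close> for each block.\<close>

fun hybrid :: "nat pmf_pair pmf \<Rightarrow> (nat \<times> nat, 's) dtree pmf \<Rightarrow> nat \<Rightarrow> (nat + nat \<times> nat, 's) dtree pmf" where
  "hybrid Q A 0 = map_pmf (map_dtree Inr id) A"
| "hybrid Q A (Suc k) = bind_pmf (hybrid Q A k) (\<lambda>t. bind_pmf Q (simulate (in_block k) (Inl k) t))"

definition replace_block :: "nat \<Rightarrow> (nat \<times> nat \<Rightarrow> bool) \<Rightarrow> (nat \<Rightarrow> bool) \<Rightarrow> nat \<times> nat \<Rightarrow> bool" where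
  "replace_block k x u = (\<lambda>(i, l). if i = k then u l else x (i, l))"

lemma merge_in_block: "merge (in_block k) (case_sum z x) u = case_sum z (replace_block k x u)"
  by (auto simp: fun_eq_iff merge_def in_block_def replace_block_def split: sum.split)

text \<open>For \<open>k = n\<close> no block variable is left, so the last hybrid consists of trees
  for \<open>f\<close>.\<close>

lemma hybrid_indices:
  assumes "set_pmf A \<subseteq> dtrees ({..<n} \<times> {..<m}) S" "k \<le> n" "t \<in> set_pmf (hybrid Q A k)"
  shows "query_indices t \<subseteq> Inl ` {..<k} \<union> Inr ` ({k..<n} \<times> {..<m}) \<and> outputs t \<subseteq> S"
  using assms(2,3)
proof (induction k arbitrary: t)
  case 0
  then obtain T where T: "T \<in> set_pmf A" "t = map_dtree Inr id T" by auto
  then have "query_indices T \<subseteq> {..<n} \<times> {..<m}" "outputs T \<subseteq> S"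
    using assms(1) by (auto simp: dtrees_def)
  then show ?case using T(2) by (auto simp: dtree.set_map atLeast0LessThan)
next
  case (Suc k)
  obtain t' p where t': "t' \<in> set_pmf (hybrid Q A k)" "t \<in> set_pmf (simulate (in_block k) (Inl k) t' p)"
    using Suc.prems by auto
  have IH: "query_indices t' \<subseteq> Inl ` {..<k} \<union> Inr ` ({k..<n} \<times> {..<m}) \<and> outputs t' \<subseteq> S"
    using Suc.IH t'(1) Suc.prems by simp
  have q: "j \<in> Inl ` {..<Suc k} \<union> Inr ` ({Suc k..<n} \<times> {..<m})" if "j \<in> query_indices t" for j
  proof -
    have "j = Inl k \<or> j \<in> query_indices t' \<and> in_block k j = None"
      using simulate_indices[OF t'(2)] that by auto
    then show ?thesis
    proof
      assume j: "j \<in> query_indices t' \<and> in_block k j = None"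
      then have "j \<in> Inl ` {..<k} \<union> Inr ` ({k..<n} \<times> {..<m})" using IH by blast
      then show ?thesis using j by (auto simp: in_block_def split: if_splits)
    qed simp
  qed
  have "query_indices t \<subseteq> Inl ` {..<Suc k} \<union> Inr ` ({Suc k..<n} \<times> {..<m})"
    using q by (rule subsetI)
  moreover have "outputs t \<subseteq> S" using IH simulate_indices[OF t'(2)] by (meson order_trans)
  ultimately show ?case ..
qed

text \<open>Blocks before \<open>k\<close> have been replaced and are unconstrained: for
  \<open>k = 0\<close> the input encodes \<open>z\<close>, for \<open>k = n\<close> any point of the
  cube will do.\<close>

definition consistent ::
  "nat \<Rightarrow> nat \<Rightarrow> ((nat \<Rightarrow> bool) \<times> bool) set \<Rightarrow> nat \<Rightarrow> (nat \<Rightarrow> bool) \<Rightarrow> (nat \<times> nat \<Rightarrow> bool) \<Rightarrow> bool" where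
  "consistent n m g k z x \<longleftrightarrow> x \<in> cube ({..<n} \<times> {..<m}) \<and>
     (\<forall>i. k \<le> i \<longrightarrow> i < n \<longrightarrow> block m x i \<in> preim g (z i))"

lemma consistent_replace_block:
  assumes "g \<subseteq> cube {..<m} \<times> UNIV" "consistent n m g (Suc k) z x" "k < n" "u \<in> preim g (z k)"
  shows "consistent n m g k z (replace_block k x u)"
proof -
  have u: "u \<in> cube {..<m}" using assms(1,4) by (auto simp: preim_def)
  have "replace_block k x u \<in> cube ({..<n} \<times> {..<m})"
    using assms(2,3) u by (auto simp: consistent_def replace_block_def cube_def PiE_iff extensional_def)
  moreover have "block m (replace_block k x u) k = u"
    using u by (auto simp: block_def replace_block_def cube_def PiE_iff extensional_def restrict_def fun_eq_iff)
  moreover have "block m (replace_block k x u) i = block m x i" if "i \<noteq> k" for i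
    using that by (auto simp: block_def replace_block_def fun_eq_iff)
  ultimately show ?thesis
    using assms(2,4) unfolding consistent_def by (metis Suc_leI le_neq_implies_less)
qed

lemma pvalue_preim: "u \<in> preim g b \<Longrightarrow> pvalue g u = b"
  unfolding pvalue_def preim_def by (rule the_equality) (auto, (metis (full_types))+)

lemma compose_consistent:
  assumes "consistent n m g 0 z x" "z \<in> cube {..<n}" "(x, s) \<in> compose n m S f g"
  shows "(z, s) \<in> f"
proof -
  have v: "block m x i \<in> preim g (z i)" if "i < n" for i
    using assms(1) that by (simp add: consistent_def)
  have "block m x i \<in> valid g" if "i < n" for i
    using v[OF that] by (cases "z i") (auto simp: valid_def)
  then have "((\<lambda>i\<in>{..<n}. pvalue g (block m x i)), s) \<in> f"
    using assms(3) by (auto simp: compose_def)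
  moreover have "(\<lambda>i\<in>{..<n}. pvalue g (block m x i)) = z"
  proof
    fix i
    show "(\<lambda>i\<in>{..<n}. pvalue g (block m x i)) i = z i"
      using assms(2) pvalue_preim[OF v, of i]
      by (cases "i < n") (simp_all add: cube_def PiE_iff extensional_def)
  qed
  ultimately show ?thesis by simp
qed

lemma set_pick_mixture:
  assumes "set_pmf Q \<subseteq> input_pairs g"
  shows "set_pmf (bind_pmf Q (pick b)) \<subseteq> preim g b"
proof
  fix u assume "u \<in> set_pmf (bind_pmf Q (pick b))"
  then obtain p where p: "p \<in> set_pmf Q" "u \<in> set_pmf (pick b p)" by auto
  then have "p \<in> input_pairs g" using assms by blast
  then have "set_pmf (pick b p) \<subseteq> preim g b"
    by (cases b) (simp_all add: input_pairs_def pick_def case_prod_unfold)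
  then show "u \<in> preim g b" using p(2) by blast
qed

text \<open>A step has the output law of the previous hybrid with block \<open>k\<close> sampled
  from the mixture for \<open>z k\<close>. Each such sample lies in \<open>preim g (z k)\<close>, so
  the bound 2/3 holds for it by induction and survives averaging.\<close>

lemma run_hybrid:
  assumes "A \<in> randomized_algorithms ({..<n} \<times> {..<m}) S (1/3) (compose n m S f g)"
    and "g \<subseteq> cube {..<m} \<times> UNIV" "set_pmf Q \<subseteq> input_pairs g" "z \<in> cube {..<n}"
    and "k \<le> n" "consistent n m g k z x"
  shows "ennreal (2/3) \<le> (\<integral>\<^sup>+ t. indicator {s. (z, s) \<in> f} (run t (case_sum z x)) \<partial>measure_pmf (hybrid Q A k))"
  using assms(5,6)
proof (induction k arbitrary: x)
  case 0
  have "run (map_dtree Inr id T) (case_sum z x) = run T x" for T :: "(nat \<times> nat, 'a) dtree"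
    by (induction T) auto
  then have "(\<integral>\<^sup>+ t. indicator {s. (z, s) \<in> f} (run t (case_sum z x)) \<partial>measure_pmf (hybrid Q A 0)) =
      (\<integral>\<^sup>+ t. indicator {T. (z, run T x) \<in> f} t \<partial>measure_pmf A)"
    by (auto intro!: nn_integral_cong simp: indicator_def)
  also have "\<dots> = ennreal (measure_pmf.prob A {T. (z, run T x) \<in> f})"
    by (simp add: measure_pmf.emeasure_eq_measure)
  finally have eq: "(\<integral>\<^sup>+ t. indicator {s. (z, s) \<in> f} (run t (case_sum z x)) \<partial>measure_pmf (hybrid Q A 0)) =
      ennreal (measure_pmf.prob A {T. (z, run T x) \<in> f})" .
  have "2/3 \<le> measure_pmf.prob A {T. (x, run T x) \<in> compose n m S f g}"
    using assms(1) 0 by (auto simp: randomized_algorithms_def consistent_def)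
  also have "\<dots> \<le> measure_pmf.prob A {T. (z, run T x) \<in> f}"
    using compose_consistent[OF 0(2) assms(4)] by (intro measure_pmf.finite_measure_mono) auto
  finally show ?case unfolding eq by (rule ennreal_leI)
next
  case (Suc k)
  let ?h = "indicator {s. (z, s) \<in> f} :: 'a \<Rightarrow> ennreal"
  let ?D = "bind_pmf Q (pick (z k))"
  have "ennreal (2/3) = (\<integral>\<^sup>+ u. ennreal (2/3) \<partial>measure_pmf ?D)" by simp
  also have "\<dots> \<le> (\<integral>\<^sup>+ u. \<integral>\<^sup>+ t. ?h (run t (case_sum z (replace_block k x u))) \<partial>measure_pmf (hybrid Q A k) \<partial>measure_pmf ?D)"
  proof (rule nn_integral_mono_AE, unfold AE_measure_pmf_iff, rule ballI)
    fix u assume "u \<in> set_pmf ?D"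
    then have "u \<in> preim g (z k)" using set_pick_mixture[OF assms(3)] by blast
    then show "ennreal (2/3) \<le> (\<integral>\<^sup>+ t. ?h (run t (case_sum z (replace_block k x u))) \<partial>measure_pmf (hybrid Q A k))"
      using Suc.prems by (intro Suc.IH consistent_replace_block assms(2)) auto
  qed
  also have "\<dots> = (\<integral>\<^sup>+ t. \<integral>\<^sup>+ u. ?h (run t (case_sum z (replace_block k x u))) \<partial>measure_pmf ?D \<partial>measure_pmf (hybrid Q A k))"
    by (rule nn_integral_pmf_commute)
  also have "\<dots> = (\<integral>\<^sup>+ t. \<integral>\<^sup>+ t'. ?h (run t' (case_sum z x))
      \<partial>measure_pmf (bind_pmf Q (simulate (in_block k) (Inl k) t)) \<partial>measure_pmf (hybrid Q A k))"
    by (subst run_simulate_mixture) (simp only: merge_in_block sum.case)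
  also have "\<dots> = (\<integral>\<^sup>+ t. ?h (run t (case_sum z x)) \<partial>measure_pmf (hybrid Q A (Suc k)))"
    by (simp only: hybrid.simps nn_integral_bind_pmf)
  finally show ?case .
qed

text \<open>The same induction as for the outputs, where each replaced block adds
  \<open>2 * \<delta>\<close> to the expected cost.\<close>

lemma cost_hybrid:
  assumes "A \<in> randomized_algorithms ({..<n} \<times> {..<m}) S (1/3) (compose n m S f g)"
    and "g \<subseteq> cube {..<m} \<times> UNIV" "near_optimal {..<m} g \<delta> Q" "0 < \<delta>"
    and "k \<le> n" "consistent n m g k z x"
  shows "(\<integral>\<^sup>+ t. cost (query_weight (max_conflict_complexity {..<m} g)) t (case_sum z x) \<partial>measure_pmf (hybrid Q A k))
    \<le> worst_case_queries ({..<n} \<times> {..<m}) A + of_nat k * (2 * \<delta>)"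
  using assms(5,6)
proof (induction k arbitrary: x)
  case 0
  let ?w = "query_weight (max_conflict_complexity {..<m} g)"
  have "cost ?w (map_dtree Inr id T) (case_sum z x) = of_nat (num_queries T x)" for T :: "(nat \<times> nat, 'a) dtree"
    by (induction T) (auto simp: query_weight_def)
  then have "(\<integral>\<^sup>+ t. cost ?w t (case_sum z x) \<partial>measure_pmf (hybrid Q A 0)) =
      (\<integral>\<^sup>+ T. of_nat (num_queries T x) \<partial>measure_pmf A)"
    by simp
  also have "\<dots> \<le> (\<integral>\<^sup>+ T. worst_case_queries ({..<n} \<times> {..<m}) A \<partial>measure_pmf A)"
  proof (rule nn_integral_mono_AE, unfold AE_measure_pmf_iff, rule ballI)
    fix T assume T: "T \<in> set_pmf A"
    have "of_nat (num_queries T x) \<le> (SUP x\<in>cube ({..<n} \<times> {..<m}). of_nat (num_queries T x) :: ennreal)"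
      using 0 by (intro SUP_upper) (simp add: consistent_def)
    also have "\<dots> \<le> worst_case_queries ({..<n} \<times> {..<m}) A"
      unfolding worst_case_queries_def by (rule SUP_upper[OF T])
    finally show "of_nat (num_queries T x) \<le> worst_case_queries ({..<n} \<times> {..<m}) A" .
  qed
  finally show ?case by simp
next
  case (Suc k)
  let ?w = "query_weight (max_conflict_complexity {..<m} g)"
  let ?D = "bind_pmf Q (pick (z k))"
  have A: "set_pmf A \<subseteq> dtrees ({..<n} \<times> {..<m}) S"
    using assms(1) by (simp add: randomized_algorithms_def)
  have Q: "set_pmf Q \<subseteq> input_pairs g" using assms(3) by (simp add: near_optimal_def)
  have "(\<integral>\<^sup>+ t. cost ?w t (case_sum z x) \<partial>measure_pmf (hybrid Q A (Suc k))) =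
      (\<integral>\<^sup>+ t. \<integral>\<^sup>+ t'. cost ?w t' (case_sum z x)
      \<partial>measure_pmf (bind_pmf Q (simulate (in_block k) (Inl k) t)) \<partial>measure_pmf (hybrid Q A k))"
    by (simp only: hybrid.simps nn_integral_bind_pmf)
  also have "\<dots> \<le> (\<integral>\<^sup>+ t. (\<integral>\<^sup>+ u. cost ?w t (case_sum z (replace_block k x u)) \<partial>measure_pmf ?D) + 2 * \<delta>
      \<partial>measure_pmf (hybrid Q A k))"
  proof (rule nn_integral_mono_AE, unfold AE_measure_pmf_iff, rule ballI)
    fix t assume "t \<in> set_pmf (hybrid Q A k)"
    then have ind: "query_indices t \<subseteq> Inl ` {..<k} \<union> Inr ` ({k..<n} \<times> {..<m})"
      using hybrid_indices[OF A, of k t Q] Suc.prems by simp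
    have "(\<integral>\<^sup>+ t'. cost ?w t' (case_sum z x) \<partial>measure_pmf (bind_pmf Q (simulate (in_block k) (Inl k) t))) \<le>
        (\<integral>\<^sup>+ u. cost ?w t (merge (in_block k) (case_sum z x) u)
          \<partial>measure_pmf (bind_pmf Q (pick (case_sum z x (Inl k))))) + 2 * \<delta>"
    proof (rule cost_simulate_mixture[OF _ assms(2-4)])
      show "?w j = 1" if "in_block k j \<noteq> None" for j
        using that by (auto simp: in_block_def query_weight_def split: sum.splits)
      show "i \<in> {..<m}" if "j \<in> query_indices t" "in_block k j = Some i" for i j
        using that ind by (auto simp: in_block_def split: if_splits)
    qed (auto simp: query_weight_def)
    then show "(\<integral>\<^sup>+ t'. cost ?w t' (case_sum z x) \<partial>measure_pmf (bind_pmf Q (simulate (in_block k) (Inl k) t))) \<le>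
        (\<integral>\<^sup>+ u. cost ?w t (case_sum z (replace_block k x u)) \<partial>measure_pmf ?D) + 2 * \<delta>"
      by (simp only: merge_in_block sum.case)
  qed
  also have "\<dots> = (\<integral>\<^sup>+ t. (\<integral>\<^sup>+ u. cost ?w t (case_sum z (replace_block k x u)) \<partial>measure_pmf ?D)
      \<partial>measure_pmf (hybrid Q A k)) + 2 * \<delta>"
    by (subst nn_integral_add) simp_all
  also have "(\<integral>\<^sup>+ t. (\<integral>\<^sup>+ u. cost ?w t (case_sum z (replace_block k x u)) \<partial>measure_pmf ?D)
      \<partial>measure_pmf (hybrid Q A k)) = (\<integral>\<^sup>+ u. (\<integral>\<^sup>+ t. cost ?w t (case_sum z (replace_block k x u))
      \<partial>measure_pmf (hybrid Q A k)) \<partial>measure_pmf ?D)"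
    by (rule nn_integral_pmf_commute)
  also have "\<dots> \<le> (\<integral>\<^sup>+ u. worst_case_queries ({..<n} \<times> {..<m}) A + of_nat k * (2 * \<delta>) \<partial>measure_pmf ?D)"
  proof (rule nn_integral_mono_AE, unfold AE_measure_pmf_iff, rule ballI)
    fix u assume "u \<in> set_pmf ?D"
    then have "u \<in> preim g (z k)" using set_pick_mixture[OF Q] by blast
    then show "(\<integral>\<^sup>+ t. cost ?w t (case_sum z (replace_block k x u)) \<partial>measure_pmf (hybrid Q A k)) \<le>
        worst_case_queries ({..<n} \<times> {..<m}) A + of_nat k * (2 * \<delta>)"
      using Suc.prems by (intro Suc.IH consistent_replace_block assms(2)) auto
  qed
  finally show ?case by (simp add: distrib_right add_ac)
qed

section \<open>From the last hybrid to an algorithm for \<open>f\<close>\<close>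

lemma run_map_dtree: "run (map_dtree r s T) x = s (run T (x \<circ> r))"
  by (induction T) auto

lemma num_queries_map_dtree: "num_queries (map_dtree r s T) x = num_queries T (x \<circ> r)"
  by (induction T) auto

lemma run_cong: "(\<And>i. i \<in> query_indices T \<Longrightarrow> x i = y i) \<Longrightarrow> run T x = run T y"
  by (induction T) auto

lemma run_in_outputs: "run T x \<in> outputs T"
  by (induction T) auto

lemma cost_query_weight:
  "query_indices T \<subseteq> range Inl \<Longrightarrow> cost (query_weight X) T y = of_nat (num_queries T y) * X"
  by (induction T) (auto simp: query_weight_def distrib_right)

text \<open>Every query of the last hybrid costs the max conflict complexity, which bounds the
  expected number of queries; Markov's inequality turns this into a worst-case bound.\<close>

lemma R_complexity_le_of_near_optimal:
  assumes A: "A \<in> randomized_algorithms ({..<n} \<times> {..<m}) S (1/3) (compose n m S f g)"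
    and g: "g \<subseteq> cube {..<m} \<times> UNIV" and Q: "near_optimal {..<m} g \<delta> Q" and \<delta>: "0 < \<delta>"
    and X: "0 < max_conflict_complexity {..<m} g"
  shows "R_complexity {..<n} S (4/9) f * max_conflict_complexity {..<m} g \<le>
    9 * (worst_case_queries ({..<n} \<times> {..<m}) A + of_nat n * (2 * \<delta>))"
proof (cases "worst_case_queries ({..<n} \<times> {..<m}) A + of_nat n * (2 * \<delta>)")
  case top
  then show ?thesis by (simp only: ennreal_mult_top) simp
next
  case (real c)
  let ?X = "max_conflict_complexity {..<m} g"
  let ?H = "hybrid Q A n"
  obtain X' where X': "?X = ennreal X'" "0 < X'"
    using max_conflict_complexity_finite[OF _ g] X by (cases ?X) auto
  \<comment> \<open>With this rounding \<open>K\<close> queries cost at most \<open>9 * c\<close>,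
    while \<open>K + 1\<close> queries cost more.\<close>
  define K where "K = nat \<lfloor>9 * c / X'\<rfloor>"
  have "real K \<le> 9 * c / X'" "9 * c / X' < real K + 1"
    using real(1) X'(2) by (auto simp: K_def)
  then have K: "real K * X' \<le> 9 * c" "9 * c < (real K + 1) * X'"
    using X'(2) by (simp_all add: field_simps)
  have A': "set_pmf A \<subseteq> dtrees ({..<n} \<times> {..<m}) S"
    using A by (simp add: randomized_algorithms_def)
  have Qg: "set_pmf Q \<subseteq> input_pairs g" using Q by (simp add: near_optimal_def)
  \<comment> \<open>A default output for truncated trees must lie in \<open>S\<close>; the support
    of \<open>A\<close> contains a tree, and its outputs are in \<open>S\<close>.\<close>
  obtain T where T: "T \<in> set_pmf A" using set_pmf_not_empty by fast
  define s where "s = run T (\<lambda>_. False)"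
  have s: "s \<in> S" using T A' run_in_outputs[of T] by (auto simp: s_def dtrees_def)
  \<comment> \<open>All queried variables are of the form \<open>Inl i\<close>, so
    \<open>projl\<close> recovers the index.\<close>
  define B where "B = map_pmf (\<lambda>t. map_dtree projl id (truncate K s t)) ?H"
  have ind: "t \<in> dtrees (Inl ` {..<n}) S" if "t \<in> set_pmf ?H" for t
    using hybrid_indices[OF A' order_refl that] by (auto simp: dtrees_def)
  have "map_dtree projl id (truncate K s t) \<in> dtrees {..<n} S" if "t \<in> set_pmf ?H" for t
    using truncate_in_dtrees[OF ind[OF that] s, of K] by (force simp: dtrees_def dtree.set_map)
  then have B: "set_pmf B \<subseteq> dtrees {..<n} S" by (auto simp: B_def)
  \<comment> \<open>The last hybrid does not query the blocks; the constantly undefined input is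
    extensional and hence lies in the cube.\<close>
  define x where "x = (\<lambda>_ :: nat \<times> nat. undefined :: bool)"
  have cons: "consistent n m g n z x" for z
    by (auto simp: consistent_def x_def cube_def)
  have correct: "1 - 4/9 \<le> measure_pmf.prob B {T. (z, run T z) \<in> f}" if z: "z \<in> cube {..<n}" for z
  proof -
    let ?y = "case_sum z x"
    let ?good = "{t. (z, run t ?y) \<in> f}" and ?bad = "{t :: (nat + nat \<times> nat, 'a) dtree. K < num_queries t ?y}"
    have "ennreal (2/3) \<le> (\<integral>\<^sup>+ t. indicator ?good t \<partial>measure_pmf ?H)"
      using run_hybrid[OF A g Qg z order_refl cons] by (simp add: indicator_def)
    then have good: "2/3 \<le> measure_pmf.prob ?H ?good"
      by (simp add: measure_pmf.emeasure_eq_measure)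
    \<comment> \<open>Markov's inequality: exceeding the budget means at least \<open>K + 1\<close>
      queries of cost \<open>X'\<close> each.\<close>
    have "ennreal ((real K + 1) * X' * measure_pmf.prob ?H ?bad) =
        (\<integral>\<^sup>+ t. ennreal ((real K + 1) * X') * indicator ?bad t \<partial>measure_pmf ?H)"
      using X'(2) by (simp add: nn_integral_cmult measure_pmf.emeasure_eq_measure ennreal_mult)
    also have "\<dots> \<le> (\<integral>\<^sup>+ t. cost (query_weight ?X) t ?y \<partial>measure_pmf ?H)"
    proof (rule nn_integral_mono_AE, unfold AE_measure_pmf_iff, rule ballI)
      fix t assume "t \<in> set_pmf ?H"
      then have "query_indices t \<subseteq> Inl ` {..<n}" using ind by (simp add: dtrees_def)
      then have "query_indices t \<subseteq> range Inl" by (rule order_trans) (intro image_mono subset_UNIV)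
      then have "cost (query_weight ?X) t ?y = ennreal (real (num_queries t ?y) * X')"
        using X' by (simp add: cost_query_weight ennreal_mult ennreal_of_nat_eq_real_of_nat)
      moreover have "(real K + 1) * X' \<le> real (num_queries t ?y) * X'" if "K < num_queries t ?y"
        using X'(2) that by (intro mult_right_mono) auto
      ultimately show "ennreal ((real K + 1) * X') * indicator ?bad t \<le> cost (query_weight ?X) t ?y"
        by (auto simp: indicator_def intro: ennreal_leI)
    qed
    also have "\<dots> \<le> ennreal c"
      using cost_hybrid[OF A g Q \<delta> order_refl cons] real(2) by simp
    finally have "(real K + 1) * X' * measure_pmf.prob ?H ?bad \<le> c"
      using real(1) by simp
    then have "(real K + 1) * X' * (9 * measure_pmf.prob ?H ?bad) \<le> (real K + 1) * X' * 1"
      using K(2) by linarith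
    then have bad: "measure_pmf.prob ?H ?bad \<le> 1/9"
      using X'(2) by (subst (asm) mult_le_cancel_left_pos) auto
    \<comment> \<open>A correct run stays correct unless truncation interferes, which leaves 2/3 -
      1/9 = 1 - 4/9.\<close>
    have "measure_pmf.prob ?H ?good \<le>
        measure_pmf.prob ?H ({t. (z, run (truncate K s t) ?y) \<in> f} \<union> ?bad)"
      by (intro measure_pmf.finite_measure_mono) (auto simp: run_truncate not_less)
    also have "\<dots> \<le> measure_pmf.prob ?H {t. (z, run (truncate K s t) ?y) \<in> f} + measure_pmf.prob ?H ?bad"
      by (intro measure_Un_le) auto
    also have "measure_pmf.prob ?H {t. (z, run (truncate K s t) ?y) \<in> f} =
        measure_pmf.prob B {T. (z, run T z) \<in> f}"
    proof -
      have "run (truncate K s t) ?y = run (map_dtree projl id (truncate K s t)) z"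
        if "t \<in> set_pmf ?H" for t
      proof -
        have "query_indices (truncate K s t) \<subseteq> Inl ` {..<n}"
          using truncate_in_dtrees[OF ind[OF that] s, of K] by (simp add: dtrees_def)
        then have "?y j = (z \<circ> projl) j" if "j \<in> query_indices (truncate K s t)" for j
          using that by auto
        then show ?thesis by (simp only: run_map_dtree id_apply) (rule run_cong)
      qed
      then show ?thesis
        unfolding B_def measure_map_pmf
        by (intro measure_pmf.finite_measure_eq_AE) (auto simp: AE_measure_pmf_iff)
    qed
    finally show ?thesis using good bad by linarith
  qed
  have "worst_case_queries {..<n} B \<le> of_nat K"
    unfolding worst_case_queries_def B_def
    by (intro SUP_least) (auto simp: num_queries_map_dtree num_queries_truncate)
  moreover have "B \<in> randomized_algorithms {..<n} S (4/9) f"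
    using B correct by (auto simp: randomized_algorithms_def)
  ultimately have "R_complexity {..<n} S (4/9) f \<le> of_nat K"
    unfolding R_complexity_def by (meson INF_lower2)
  then have "R_complexity {..<n} S (4/9) f * ?X \<le> of_nat K * ?X"
    by (rule mult_right_mono) simp
  also have "\<dots> = ennreal (real K * X')"
    using X' by (simp add: ennreal_mult ennreal_of_nat_eq_real_of_nat)
  also have "\<dots> \<le> ennreal (9 * c)" using K(1) by (rule ennreal_leI)
  also have "\<dots> = 9 * ennreal c" using real(1) by (simp add: ennreal_mult)
  finally show ?thesis using real(2) by simp
qed

section \<open>The constant 1/9 and the choice of the output type\<close>

text \<open>The additive error vanishes as \<open>\<delta>\<close> tends to 0; for max conflict
  complexity 0 there is nothing to prove.\<close>

lemma composition_bound_ninth: "composition_bound TYPE('s) (1/9)"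
  unfolding composition_bound_def
proof (intro allI impI)
  fix n m :: nat and S :: "'s set" and f :: "((nat \<Rightarrow> bool) \<times> 's) set" and g :: "((nat \<Rightarrow> bool) \<times> bool) set"
  assume "partial_boolean_function {..<m} g"
  then have g: "g \<subseteq> cube {..<m} \<times> UNIV" by (simp add: partial_boolean_function_def)
  let ?X = "max_conflict_complexity {..<m} g" and ?R = "R_complexity {..<n} S (4/9) f"
  have "ennreal (1/9) * ?R * ?X \<le> worst_case_queries ({..<n} \<times> {..<m}) A"
    if A: "A \<in> randomized_algorithms ({..<n} \<times> {..<m}) S (1/3) (compose n m S f g)" for A
  proof (cases "?X = 0")
    case False
    let ?W = "worst_case_queries ({..<n} \<times> {..<m}) A"
    have "?R * ?X \<le> 9 * ?W"
    proof (rule ennreal_le_epsilon)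
      fix e :: real assume e: "0 < e"
      \<comment> \<open>The total error \<open>9 * n * 2 * d\<close> is then at most
        \<open>e\<close>; \<open>n + 1\<close> keeps the denominator positive.\<close>
      define d where "d = e / (18 * (real n + 1))"
      have d: "0 < d" using e by (simp add: d_def)
      obtain Q where "near_optimal {..<m} g (ennreal d) Q"
        using ex_near_optimal[OF _ g, of "ennreal d"] d False by (auto simp: zero_less_iff_neq_zero)
      then have "?R * ?X \<le> 9 * (?W + of_nat n * (2 * ennreal d))"
        using A g d False by (intro R_complexity_le_of_near_optimal) (auto simp: zero_less_iff_neq_zero)
      also have "\<dots> = 9 * ?W + ennreal (18 * real n * d)"
        using d by (simp add: distrib_left ennreal_mult ennreal_of_nat_eq_real_of_nat mult_ac)
      also have "18 * real n * d \<le> e"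
        using e by (simp add: d_def field_simps)
      finally show "?R * ?X \<le> 9 * ?W + ennreal e"
        by (auto intro: order_trans add_left_mono ennreal_leI)
    qed
    then have "ennreal (1/9) * (?R * ?X) \<le> ennreal (1/9) * (9 * ?W)" by (rule mult_left_mono) simp
    also have "\<dots> = ?W"
    proof -
      have "ennreal (1/9) * 9 = ennreal (1/9 * 9)" by (subst ennreal_mult) simp_all
      then show ?thesis by (simp flip: mult.assoc)
    qed
    finally show ?thesis by (simp add: mult.assoc)
  qed simp
  then show "ennreal (1/9) * ?R * ?X \<le> R_complexity ({..<n} \<times> {..<m}) S (1/3) (compose n m S f g)"
    unfolding R_complexity_def[of "{..<n} \<times> {..<m}"] by (rule INF_greatest)
qed

text \<open>Relabelling the leaves keeps every query and turns algorithms for \<open>h\<close> into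
  algorithms for \<open>h'\<close>.\<close>

lemma R_complexity_map_outputs:
  assumes "\<phi> ` S \<subseteq> S'" "\<And>x s. (x, s) \<in> h \<Longrightarrow> (x, \<phi> s) \<in> h'"
  shows "R_complexity I S' \<epsilon> h' \<le> R_complexity I S \<epsilon> h"
  unfolding R_complexity_def
proof (rule INF_mono)
  fix A assume A: "A \<in> randomized_algorithms I S \<epsilon> h"
  let ?B = "map_pmf (map_dtree id \<phi>) A"
  have "1 - \<epsilon> \<le> measure_pmf.prob ?B {T. (x, run T x) \<in> h'}" if "x \<in> cube I" for x
  proof -
    have "1 - \<epsilon> \<le> measure_pmf.prob A {T. (x, run T x) \<in> h}"
      using A that by (auto simp: randomized_algorithms_def)
    also have "\<dots> \<le> measure_pmf.prob A {T. (x, \<phi> (run T x)) \<in> h'}"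
      using assms(2) by (intro measure_pmf.finite_measure_mono) auto
    finally show ?thesis by (simp add: vimage_def run_map_dtree)
  qed
  moreover have "set_pmf ?B \<subseteq> dtrees I S'"
    using A assms(1) by (force simp: randomized_algorithms_def dtrees_def dtree.set_map)
  ultimately have "?B \<in> randomized_algorithms I S' \<epsilon> h'" by (simp add: randomized_algorithms_def)
  moreover have "worst_case_queries I ?B = worst_case_queries I A"
    by (simp add: worst_case_queries_def image_image num_queries_map_dtree)
  ultimately show "\<exists>B\<in>randomized_algorithms I S' \<epsilon> h'. worst_case_queries I B \<le> worst_case_queries I A"
    by (intro bexI[of _ ?B]) simp_all
qed

text \<open>Only the set of inputs to which an output is related matters, and there are finitely many
  such sets, so the outputs may be replaced by natural numbers.\<close>

lemma composition_bound_transfer: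
  assumes "composition_bound TYPE(nat) c"
  shows "composition_bound TYPE('s) c"
  unfolding composition_bound_def
proof (intro allI impI)
  fix n m :: nat and S :: "'s set" and f :: "((nat \<Rightarrow> bool) \<times> 's) set" and g :: "((nat \<Rightarrow> bool) \<times> bool) set"
  assume f: "f \<subseteq> cube {..<n} \<times> S" and g: "partial_boolean_function {..<m} g"
  define F where "F s = {z. (z, s) \<in> f}" for s
  have "finite (Pow (cube {..<n}))" by (simp add: cube_def finite_PiE)
  moreover have "range F \<subseteq> Pow (cube {..<n})" using f by (auto simp: F_def)
  ultimately have "finite (range F)" by (rule rev_finite_subset)
  then obtain e :: "(nat \<Rightarrow> bool) set \<Rightarrow> nat" where e: "inj_on e (range F)"
    using finite_imp_inj_to_nat_seg by metis
  define \<phi> where "\<phi> s = e (F s)" for s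
  have \<phi>: "(z, s) \<in> f \<longleftrightarrow> (z, s') \<in> f" if "\<phi> s = \<phi> s'" for z s s'
    using that inj_onD[OF e, of "F s" "F s'"] by (auto simp: \<phi>_def F_def)
  define f' where "f' = (\<lambda>(z, s). (z, \<phi> s)) ` f"
  have f': "f' \<subseteq> cube {..<n} \<times> \<phi> ` S" using f by (auto simp: f'_def)
  \<comment> \<open>Decoding a number by \<open>inv_into\<close> may give another output than the
    encoded one, but one related to the same inputs.\<close>
  have "R_complexity {..<n} S (4/9) f \<le> R_complexity {..<n} (\<phi> ` S) (4/9) f'"
  proof (rule R_complexity_map_outputs[where \<phi> = "inv_into S \<phi>"])
    show "inv_into S \<phi> ` \<phi> ` S \<subseteq> S" by (auto intro: inv_into_into)
    fix z k assume "(z, k) \<in> f'"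
    then obtain s where s: "(z, s) \<in> f" "k = \<phi> s" by (auto simp: f'_def)
    then have "s \<in> S" using f by auto
    then have "\<phi> (inv_into S \<phi> k) = \<phi> s" using s(2) by (simp add: f_inv_into_f)
    then show "(z, inv_into S \<phi> k) \<in> f" using \<phi> s(1) by blast
  qed
  then have "ennreal c * R_complexity {..<n} S (4/9) f * max_conflict_complexity {..<m} g \<le>
      ennreal c * R_complexity {..<n} (\<phi> ` S) (4/9) f' * max_conflict_complexity {..<m} g"
    by (intro mult_right_mono mult_left_mono) auto
  also have "\<dots> \<le> R_complexity ({..<n} \<times> {..<m}) (\<phi> ` S) (1/3) (compose n m (\<phi> ` S) f' g)"
    using assms f' g by (auto simp: composition_bound_def)
  also have "\<dots> \<le> R_complexity ({..<n} \<times> {..<m}) S (1/3) (compose n m S f g)"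
    by (rule R_complexity_map_outputs[where \<phi> = \<phi>]) (auto simp: compose_def f'_def intro: rev_image_eqI)
  finally show "ennreal c * R_complexity {..<n} S (4/9) f * max_conflict_complexity {..<m} g \<le>
      R_complexity ({..<n} \<times> {..<m}) S (1/3) (compose n m S f g)" .
qed

theorem mainTheorem2:
  "(\<exists>c>0. composition_bound TYPE(nat) c) \<and>
   (\<forall>c>0. composition_bound TYPE(nat) c \<longrightarrow> composition_bound TYPE('s) c)"
proof (intro conjI allI impI)
  show "\<exists>c>0. composition_bound TYPE(nat) c"
    by (intro exI[of _ "1/9"] conjI composition_bound_ninth) simp
qed (rule composition_bound_transfer)

end
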